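(* Let $n\ge 2$, $\beta_1\in\mathbb{R}$, $\beta_2>0$, and set $\theta_2=\tfrac14\beta_2$, $\theta_1=\tfrac12(\beta_1+\beta_2)$. (a) The law of $x$ under $\mathbb{P}_{n,\beta}$ has the following mixture representation. Let $\phi=(\phi_1,\dots,\phi_n)\sim\mathbb{F}_n$ and, given $\phi$, let $\{x_{ij}\}_{1\le i<j\le n}\in\{0,1\}$ be mutually independent Bernoulli variables with parameter $$\frac{e^{\theta_2(\phi_i+\phi_j)+\theta_1}}{e^{\theta_2(\phi_i+\phi_j)+\theta_1}+e^{-\theta_2(\phi_i+\phi_j)-\theta_1}}=\frac{e^{2\theta_2(\phi_i+\phi_j)+2\theta_1}}{e^{2\theta_2(\phi_i+\phi_j)+2\theta_1}+1}.$$ Then $x$ (with $x_{ji}=x_{ij}$, $x_{ii}=0$) has law $\mathbb{P}_{n,\beta}$. The conditional law of $x$ given $\phi$ is $$\mathbb{P}_{n,\beta}(x\mid\phi)=\frac{e^{\sum_{i=1}^n d_i(x)(2\theta_2\phi_i+\theta_1)}}{\prod_{1\le i<j\le n}\{e^{2\theta_2(\phi_i+\phi_j)+2\theta_1}+1\}},$$ where $d_i(x)=\sum_{j\ne i}x_{ij}$. (b) Consider the Gibbs sampler on symmetric matrices $y=(y_{ij})$ with zero diagonal and off-diagonal entries in $\{-1,1\}$, each iteration of which consists of the following two steps: (i) given $y$, draw $\phi_1,\dots,\phi_n$ mutually independent with $\phi_i\sim N\big(\frac{k_i}{n-1},\frac{1}{\theta_2(n-1)}\big)$, where $k_i=\sum_{j\ne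 i}y_{ij}$; (ii) given $\phi$, draw a new $y$ with $\{y_{ij}\}_{1\le i<j\le n}$ mutually independent, taking values in $\{-1,1\}$, with $$\mathbb{P}(y_{ij}=1\mid\phi)=\frac{e^{\theta_2(\phi_i+\phi_j)+\theta_1}}{e^{\theta_2(\phi_i+\phi_j)+\theta_1}+e^{-\theta_2(\phi_i+\phi_j)-\theta_1}}.$$ Then, from any initial $y$, the distribution of $y$ after $l$ iterations of the Gibbs sampler converges in total variation, as $l\to\infty$, to the law of $y$ under $\mathbb{P}_{n,\beta}$.
   Context: $\mathcal{X}_n$ is the set of simple graphs on $\{1,\dots,n\}$, identified with their adjacency matrices $x=(x_{ij})$ (symmetric, zero diagonal, $0/1$ off-diagonal entries). The two star model is the probability mass function on $\mathcal{X}_n$ $$\mathbb{P}_{n,\beta}(x)=\frac{1}{Z_n(\beta)}\exp\Big\{\frac{\beta_2}{n-1}T(x)+\Big(\beta_1+\frac{\beta_2}{n-1}\Big)E(x)\Big\},$$ with $T(x)=\sum_i\sum_{j<l;\,j,l\ne i}x_{ij}x_{il}$ (number of two stars), $E(x)=\sum_{i<j}x_{ij}$ (number of edges), and $Z_n(\beta)$ the normalizing constant. For $x\in\mathcal{X}_n$ define $y=(y_{ij})$ by $y_{ij}=2x_{ij}-1\in\{-1,1\}$ for $i\ne j$ and $y_{ii}=0$; "the law of $y$ under $\mathbb{P}_{n,\beta}$" is the law of this matrix when $x\sim\mathbb{P}_{n,\beta}$. $\mathbb{F}_n$ is the law of $\phi=(\phi_1,\dots,\phi_n)$ when $x\sim\mathbb{P}_{n,\beta}$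 and, given $y$, the $\phi_i$ are mutually independent with $\phi_i\sim N\big(\frac{k_i}{n-1},\frac{1}{(n-1)\theta_2}\big)$, $k_i=\sum_{j\ne i}y_{ij}$. Here $\mathbb{P}_{n,\beta}$ also denotes the joint law of $(x,y,\phi)$. (Equivalently, $\mathbb{F}_n$ has density on $\mathbb{R}^n$ proportional to $\exp\{-\frac{(n-1)\theta_2}{2}\sum_{i}\phi_i^2+\sum_{i<j}\log\cosh[\theta_2(\phi_i+\phi_j)+\theta_1]\}$.) *)

theory Defs
  imports "HOL-Probability.Probability"
begin

text \<open>
  Matrices indexed by \<open>{1..n}\<close> are functions \<open>nat \<Rightarrow> nat \<Rightarrow> real\<close> that vanish outside
  \<open>{1..n} \<times> {1..n}\<close>, so that each matrix is represented by exactly one function.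
\<close>

type_synonym matrix = "nat \<Rightarrow> nat \<Rightarrow> real"

definition pairs :: "nat \<Rightarrow> (nat \<times> nat) set" where
  "pairs n = {(i, j). 1 \<le> i \<and> i < j \<and> j \<le> n}"

definition sym_matrices :: "real set \<Rightarrow> nat \<Rightarrow> matrix set" where
  "sym_matrices V n = {x.
     (\<forall>i\<in>{1..n}. \<forall>j\<in>{1..n}. i \<noteq> j \<longrightarrow> x i j \<in> V) \<and>
     (\<forall>i j. x i j = x j i) \<and> (\<forall>i. x i i = 0) \<and>
     (\<forall>i j. i \<notin> {1..n} \<or> j \<notin> {1..n} \<longrightarrow> x i j = 0)}"

definition graphs :: "nat \<Rightarrow> matrix set" where
  "graphs n = sym_matrices {0, 1} n"

definition spins :: "nat \<Rightarrow> matrix set" where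
  "spins n = sym_matrices {-1, 1} n"

text \<open>The symmetric matrix with zero diagonal and upper triangle \<open>e\<close>.\<close>

definition sym_of_upper :: "nat \<Rightarrow> (nat \<times> nat \<Rightarrow> real) \<Rightarrow> matrix" where
  "sym_of_upper n e = (\<lambda>i j. if (i, j) \<in> pairs n then e (i, j)
                             else if (j, i) \<in> pairs n then e (j, i) else 0)"

definition row_sum :: "nat \<Rightarrow> matrix \<Rightarrow> nat \<Rightarrow> real" where
  "row_sum n x i = (\<Sum>j\<in>{1..n} - {i}. x i j)"


section \<open>The two star model\<close>

definition two_stars :: "nat \<Rightarrow> matrix \<Rightarrow> real" where
  "two_stars n x = (\<Sum>i\<in>{1..n}. \<Sum>j\<in>{1..n} - {i}. \<Sum>l\<in>{j<..n} - {i}. x i j * x i l)"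

definition num_edges :: "nat \<Rightarrow> matrix \<Rightarrow> real" where
  "num_edges n x = (\<Sum>(i, j)\<in>pairs n. x i j)"

definition weight :: "nat \<Rightarrow> real \<Rightarrow> real \<Rightarrow> matrix \<Rightarrow> real" where
  "weight n \<beta>\<^sub>1 \<beta>\<^sub>2 x =
     exp (\<beta>\<^sub>2 / (real n - 1) * two_stars n x + (\<beta>\<^sub>1 + \<beta>\<^sub>2 / (real n - 1)) * num_edges n x)"

definition partition_fun :: "nat \<Rightarrow> real \<Rightarrow> real \<Rightarrow> real" where
  "partition_fun n \<beta>\<^sub>1 \<beta>\<^sub>2 = (\<Sum>x\<in>graphs n. weight n \<beta>\<^sub>1 \<beta>\<^sub>2 x)"

definition two_star_model :: "nat \<Rightarrow> real \<Rightarrow> real \<Rightarrow> matrix pmf" where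
  "two_star_model n \<beta>\<^sub>1 \<beta>\<^sub>2 =
     embed_pmf (\<lambda>x. if x \<in> graphs n then weight n \<beta>\<^sub>1 \<beta>\<^sub>2 x / partition_fun n \<beta>\<^sub>1 \<beta>\<^sub>2 else 0)"

lemma finite_pairs [simp]: "finite (pairs n)"
  by (rule finite_subset[of _ "{..n} \<times> {..n}"]) (auto simp: pairs_def)

lemma finite_sym_matrices:
  assumes "finite V"
  shows "finite (sym_matrices V n)"
proof -
  have "sym_matrices V n \<subseteq> sym_of_upper n ` PiE_dflt (pairs n) 0 (\<lambda>_. V)"
  proof
    fix x assume x: "x \<in> sym_matrices V n"
    let ?e = "\<lambda>p. if p \<in> pairs n then x (fst p) (snd p) else 0"
    have "x = sym_of_upper n ?e"
    proof (intro ext)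
      fix i j
      show "x i j = sym_of_upper n ?e i j"
        using x by (cases i j rule: linorder_cases)
          (auto simp: sym_matrices_def sym_of_upper_def pairs_def)
    qed
    moreover have "?e \<in> PiE_dflt (pairs n) 0 (\<lambda>_. V)"
      using x by (auto simp: PiE_dflt_def sym_matrices_def pairs_def)
    ultimately show "x \<in> sym_of_upper n ` PiE_dflt (pairs n) 0 (\<lambda>_. V)"
      by blast
  qed
  moreover have "finite (PiE_dflt (pairs n) 0 (\<lambda>_. V))"
    using assms by (intro finite_PiE_dflt) auto
  ultimately show ?thesis
    by (meson finite_imageI finite_subset)
qed

lemma finite_graphs: "finite (graphs n)"
  by (simp add: graphs_def finite_sym_matrices)

lemma partition_fun_pos: "partition_fun n \<beta>\<^sub>1 \<beta>\<^sub>2 > 0"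
proof -
  have "(\<lambda>_ _. 0) \<in> graphs n"
    by (simp add: graphs_def sym_matrices_def)
  then show ?thesis
    unfolding partition_fun_def
    by (intro sum_pos) (auto simp: finite_graphs weight_def)
qed

lemma pmf_two_star_model:
  "pmf (two_star_model n \<beta>\<^sub>1 \<beta>\<^sub>2) x =
     (if x \<in> graphs n then weight n \<beta>\<^sub>1 \<beta>\<^sub>2 x / partition_fun n \<beta>\<^sub>1 \<beta>\<^sub>2 else 0)"
  unfolding two_star_model_def
proof (rule pmf_embed_pmf)
  let ?f = "\<lambda>x. if x \<in> graphs n then weight n \<beta>\<^sub>1 \<beta>\<^sub>2 x / partition_fun n \<beta>\<^sub>1 \<beta>\<^sub>2 else 0"
  show nn: "0 \<le> ?f x" for x
    using partition_fun_pos[of n \<beta>\<^sub>1 \<beta>\<^sub>2] by (auto simp: weight_def)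
  have "(\<integral>\<^sup>+x. ennreal (?f x) \<partial>count_space UNIV) = (\<Sum>x\<in>graphs n. ennreal (?f x))"
    by (rule nn_integral_count_space'[OF finite_graphs]) auto
  also have "\<dots> = ennreal (\<Sum>x\<in>graphs n. ?f x)"
    by (intro sum_ennreal nn)
  also have "(\<Sum>x\<in>graphs n. ?f x) = 1"
    using partition_fun_pos[of n \<beta>\<^sub>1 \<beta>\<^sub>2]
    by (simp add: sum_divide_distrib[symmetric] partition_fun_def[symmetric])
  finally show "(\<integral>\<^sup>+x. ennreal (?f x) \<partial>count_space UNIV) = 1"
    by simp
qed

definition spin :: "nat \<Rightarrow> matrix \<Rightarrow> matrix" where
  "spin n x = (\<lambda>i j. if i \<in> {1..n} \<and> j \<in> {1..n} \<and> i \<noteq> j then 2 * x i j - 1 else 0)"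


section \<open>The auxiliary variables\<close>

abbreviation vec_space :: "nat \<Rightarrow> (nat \<Rightarrow> real) measure" where
  "vec_space n \<equiv> PiM {1..n} (\<lambda>_. borel)"

text \<open>\<^const>\<open>normal_density\<close> takes the standard deviation, not the variance.\<close>

definition normal_law :: "real \<Rightarrow> real \<Rightarrow> real measure" where
  "normal_law \<mu> v = density lborel (normal_density \<mu> (sqrt v))"

text \<open>The conditional law of \<open>\<phi>\<close> given \<open>y\<close>; here \<open>row_sum n y i\<close> is \<open>k\<^sub>i\<close>.\<close>

definition phi_given_spin :: "nat \<Rightarrow> real \<Rightarrow> matrix \<Rightarrow> (nat \<Rightarrow> real) measure" where
  "phi_given_spin n \<theta>\<^sub>2 y =
     PiM {1..n} (\<lambda>i. normal_law (row_sum n y i / (real n - 1)) (1 / ((real n - 1) * \<theta>\<^sub>2)))"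

text \<open>The joint law of \<open>(x, y, \<phi>)\<close>, with \<open>\<theta>\<^sub>2 = \<beta>\<^sub>2 / 4\<close>.\<close>

definition joint_law :: "nat \<Rightarrow> real \<Rightarrow> real \<Rightarrow> (matrix \<times> matrix \<times> (nat \<Rightarrow> real)) measure" where
  "joint_law n \<beta>\<^sub>1 \<beta>\<^sub>2 =
     measure_pmf (two_star_model n \<beta>\<^sub>1 \<beta>\<^sub>2) \<bind>
       (\<lambda>x. distr (phi_given_spin n (\<beta>\<^sub>2 / 4) (spin n x))
          (count_space UNIV \<Otimes>\<^sub>M (count_space UNIV \<Otimes>\<^sub>M vec_space n))
          (\<lambda>\<phi>. (x, spin n x, \<phi>)))"

text \<open>The law \<open>F\<^sub>n\<close> of \<open>\<phi>\<close>.\<close>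

definition phi_law :: "nat \<Rightarrow> real \<Rightarrow> real \<Rightarrow> (nat \<Rightarrow> real) measure" where
  "phi_law n \<beta>\<^sub>1 \<beta>\<^sub>2 = distr (joint_law n \<beta>\<^sub>1 \<beta>\<^sub>2) (vec_space n) (\<lambda>(x, y, \<phi>). \<phi>)"


section \<open>Independent edges given the auxiliary variables\<close>

definition edge_prob :: "real \<Rightarrow> real \<Rightarrow> (nat \<Rightarrow> real) \<Rightarrow> nat \<Rightarrow> nat \<Rightarrow> real" where
  "edge_prob \<theta>\<^sub>1 \<theta>\<^sub>2 \<phi> i j =
     exp (\<theta>\<^sub>2 * (\<phi> i + \<phi> j) + \<theta>\<^sub>1) /
     (exp (\<theta>\<^sub>2 * (\<phi> i + \<phi> j) + \<theta>\<^sub>1) + exp (- \<theta>\<^sub>2 * (\<phi> i + \<phi> j) - \<theta>\<^sub>1))"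

definition graph_given_phi :: "nat \<Rightarrow> real \<Rightarrow> real \<Rightarrow> (nat \<Rightarrow> real) \<Rightarrow> matrix pmf" where
  "graph_given_phi n \<theta>\<^sub>1 \<theta>\<^sub>2 \<phi> =
     map_pmf (sym_of_upper n)
       (Pi_pmf (pairs n) 0
         (\<lambda>(i, j). map_pmf (\<lambda>b. if b then 1 else 0) (bernoulli_pmf (edge_prob \<theta>\<^sub>1 \<theta>\<^sub>2 \<phi> i j))))"

definition spin_given_phi :: "nat \<Rightarrow> real \<Rightarrow> real \<Rightarrow> (nat \<Rightarrow> real) \<Rightarrow> matrix pmf" where
  "spin_given_phi n \<theta>\<^sub>1 \<theta>\<^sub>2 \<phi> =
     map_pmf (sym_of_upper n)
       (Pi_pmf (pairs n) 0
         (\<lambda>(i, j). map_pmf (\<lambda>b. if b then 1 else -1) (bernoulli_pmf (edge_prob \<theta>\<^sub>1 \<theta>\<^sub>2 \<phi> i j))))"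

text \<open>
  The kernel \<open>K\<close> from \<open>N\<close> to \<open>S\<close> is a (regular) conditional law, under \<open>M\<close>, of the
  \<open>S\<close>-valued random variable \<open>X\<close> given the \<open>N\<close>-valued random variable \<open>Y\<close>: the conditional
  probability of each event \<open>X \<in> A\<close> given the sigma-algebra generated by \<open>Y\<close> is \<open>K Y A\<close>.
\<close>

definition is_cond_law ::
  "'w measure \<Rightarrow> ('w \<Rightarrow> 'a) \<Rightarrow> 'a measure \<Rightarrow> ('w \<Rightarrow> 'b) \<Rightarrow> 'b measure \<Rightarrow> ('b \<Rightarrow> 'a measure) \<Rightarrow> bool"
where
  "is_cond_law M X S Y N K \<longleftrightarrow>
     X \<in> M \<rightarrow>\<^sub>M S \<and> Y \<in> M \<rightarrow>\<^sub>M N \<and> K \<in> N \<rightarrow>\<^sub>M prob_algebra S \<and>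
     (\<forall>A\<in>sets S. AE \<omega> in M.
        real_cond_exp M (vimage_algebra (space M) Y N) (indicat_real (X -` A \<inter> space M)) \<omega>
          = measure (K (Y \<omega>)) A)"


section \<open>The Gibbs sampler\<close>

definition gibbs_step :: "nat \<Rightarrow> real \<Rightarrow> real \<Rightarrow> matrix \<Rightarrow> matrix measure" where
  "gibbs_step n \<theta>\<^sub>1 \<theta>\<^sub>2 y =
     phi_given_spin n \<theta>\<^sub>2 y \<bind> (\<lambda>\<phi>. measure_pmf (spin_given_phi n \<theta>\<^sub>1 \<theta>\<^sub>2 \<phi>))"

text \<open>The distribution of \<open>y\<close> after \<open>l\<close> iterations, started at \<open>y\<^sub>0\<close>.\<close>

primrec gibbs_law :: "nat \<Rightarrow> real \<Rightarrow> real \<Rightarrow> matrix \<Rightarrow> nat \<Rightarrow> matrix measure" where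
  "gibbs_law n \<theta>\<^sub>1 \<theta>\<^sub>2 y\<^sub>0 0 = return (count_space UNIV) y\<^sub>0"
| "gibbs_law n \<theta>\<^sub>1 \<theta>\<^sub>2 y\<^sub>0 (Suc l) = gibbs_law n \<theta>\<^sub>1 \<theta>\<^sub>2 y\<^sub>0 l \<bind> gibbs_step n \<theta>\<^sub>1 \<theta>\<^sub>2"

text \<open>Intended for probability measures on the same sigma-algebra.\<close>

definition tv_dist :: "'a measure \<Rightarrow> 'a measure \<Rightarrow> real" where
  "tv_dist M N = (SUP A\<in>sets M. \<bar>measure M A - measure N A\<bar>)"

end

theory Submission
  imports Defs
begin

text \<open>
  Write \<open>p\<close> for the two star model, \<open>f\<^sub>x\<close> for the Gaussian density of \<open>\<phi>\<close> given \<open>x\<close>, and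
  \<open>q\<^sub>\<phi>\<close> for the law of a graph with independent edges given \<open>\<phi>\<close>. Everything rests on one
  identity, \<open>bayes_identity\<close>:
  \<open>p x * f\<^sub>x \<phi> = G \<phi> * q\<^sub>\<phi> x\<close>,
  with a factor \<open>G\<close> that does not depend on \<open>x\<close>. The reason is a completed square. In terms of
  the degrees \<open>d\<^sub>i\<close>, the model weight is \<open>exp (2\<theta>\<^sub>2/(n-1) \<Sum> d\<^sub>i\<^sup>2 + \<beta>\<^sub>1/2 \<Sum> d\<^sub>i)\<close>, because
  \<open>\<Sum> d\<^sub>i = 2E\<close> and \<open>\<Sum> d\<^sub>i\<^sup>2 = 2T + 2E\<close>. The mean of \<open>\<phi>\<^sub>i\<close> is \<open>2 d\<^sub>i/(n-1) - 1\<close>, and its variance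
  is chosen so that the exponent of the Gaussian contributes exactly
  \<open>-2\<theta>\<^sub>2/(n-1) \<Sum> d\<^sub>i\<^sup>2\<close>. What is left is linear in the degrees, so given \<open>\<phi>\<close> it factors
  over the edges.

  Summing the identity over \<open>x\<close> shows that \<open>G\<close> is the density of the law of \<open>\<phi>\<close>. Integrating
  it against test functions gives \<open>joint_law_disintegration\<close>: under the joint law the graph
  may be resampled from \<open>q\<^sub>\<phi>\<close> without changing the law. The mixture representation
  (\<open>phi_law_bind_graph_given_phi\<close>), the conditional law (\<open>is_cond_law_joint_law\<close>) and the
  stationarity of the Gibbs sampler (\<open>gibbs_stationary\<close>) are three choices of the test
  function.

  For the convergence, one iteration of the sampler is a Markov kernel on the finite set of
  spin matrices, and all its entries are positive, since every matrix has positive probability for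
  every \<open>\<phi>\<close> (\<open>gibbs_step_kernel\<close>). Such a kernel contracts the \<open>\<ell>\<^sup>1\<close> distance between
  two laws by a fixed factor less than 1 (\<open>positive_kernel_contraction\<close>), so the laws of the
  iterates approach the stationary law geometrically.
\<close>

(* Index sets are {1..n}; rewriting 1 to Suc 0 would turn vec_space into a form that the
   measurability rules do not match. *)
declare One_nat_def [simp del]


section \<open>Degrees, edges and two stars\<close>

lemma sum_off_diagonal_eq_sum_pairs:
  fixes f :: "nat \<Rightarrow> nat \<Rightarrow> real"
  shows "(\<Sum>i\<in>{1..n}. \<Sum>j\<in>{1..n} - {i}. f i j) = (\<Sum>(i, j)\<in>pairs n. f i j + f j i)"
proof -
  have "(SIGMA i:{1..n}. {1..n} - {i}) = pairs n \<union> prod.swap ` pairs n"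
    by (auto simp: pairs_def image_iff)
  moreover have "pairs n \<inter> prod.swap ` pairs n = {}"
    by (auto simp: pairs_def)
  ultimately have "(\<Sum>(i, j)\<in>(SIGMA i:{1..n}. {1..n} - {i}). f i j) =
      (\<Sum>(i, j)\<in>pairs n. f i j) + (\<Sum>(i, j)\<in>prod.swap ` pairs n. f i j)"
    by (simp add: sum.union_disjoint)
  also have "(\<Sum>(i, j)\<in>prod.swap ` pairs n. f i j) = (\<Sum>(i, j)\<in>pairs n. f j i)"
    by (subst sum.reindex) (auto simp: inj_on_def case_prod_unfold)
  finally show ?thesis
    by (subst sum.Sigma) (auto simp: sum.distrib case_prod_unfold)
qed

lemma sum_row_sum_mult:
  assumes "\<And>i j. x i j = x j i"
  shows "(\<Sum>i\<in>{1..n}. row_sum n x i * c i) = (\<Sum>(i, j)\<in>pairs n. x i j * (c i + c j))"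
  unfolding row_sum_def sum_distrib_right sum_off_diagonal_eq_sum_pairs
  by (rule sum.cong) (auto simp: algebra_simps assms)

text \<open>
  The double sum runs over \<open>j < l\<close>, which is how \<^const>\<open>two_stars\<close> counts pairs of edges at a
  vertex.
\<close>

lemma square_sum_eq:
  fixes a :: "nat \<Rightarrow> real"
  assumes "finite A"
  shows "(\<Sum>j\<in>A. a j)\<^sup>2 = (\<Sum>j\<in>A. (a j)\<^sup>2) + 2 * (\<Sum>j\<in>A. \<Sum>l\<in>{l \<in> A. j < l}. a j * a l)"
  using assms
proof (induction A rule: finite_linorder_max_induct)
  case empty
  then show ?case by simp
next
  case (insert b A)
  have b: "{l \<in> insert b A. b < l} = {}" and "b \<notin> A"
    using insert by auto
  have "(\<Sum>l\<in>{l \<in> insert b A. j < l}. a j * a l) = (\<Sum>l\<in>{l \<in> A. j < l}. a j * a l) + a j * a b"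
    if "j \<in> A" for j
  proof -
    have "{l \<in> insert b A. j < l} = insert b {l \<in> A. j < l}"
      using that insert by auto
    then show ?thesis
      using insert \<open>b \<notin> A\<close> by (simp add: add.commute)
  qed
  then show ?case
    using insert \<open>b \<notin> A\<close> unfolding sum.insert[OF insert(1) \<open>b \<notin> A\<close>] b
    by (simp add: power2_sum sum.distrib algebra_simps flip: sum_distrib_right sum_distrib_left)
qed

lemma graphs_sym: "x \<in> graphs n \<Longrightarrow> x i j = x j i"
  by (auto simp: graphs_def sym_matrices_def)

lemma graphs_entry:
  assumes "x \<in> graphs n" "i \<in> {1..n}" "j \<in> {1..n}" "i \<noteq> j"
  shows "x i j \<in> {0, 1}"
  using assms unfolding graphs_def sym_matrices_def by blast

lemma sum_row_sum_eq: "x \<in> graphs n \<Longrightarrow> (\<Sum>i\<in>{1..n}. row_sum n x i) = 2 * num_edges n x"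
  using sum_row_sum_mult[of x n "\<lambda>_. 1"] graphs_sym[of x n]
  by (simp add: num_edges_def sum_distrib_left case_prod_unfold mult.commute)

text \<open>
  A vertex of degree \<open>d\<close> is the centre of \<open>d (d - 1) / 2\<close> two stars, since \<open>x\<^sup>2 = x\<close> for
  the entries of an adjacency matrix.
\<close>

lemma sum_row_sum_square:
  assumes x: "x \<in> graphs n"
  shows "(\<Sum>i\<in>{1..n}. (row_sum n x i)\<^sup>2) = 2 * two_stars n x + 2 * num_edges n x"
proof -
  have "(row_sum n x i)\<^sup>2 = row_sum n x i +
      2 * (\<Sum>j\<in>{1..n} - {i}. \<Sum>l\<in>{j<..n} - {i}. x i j * x i l)" if "i \<in> {1..n}" for i
  proof -
    have "(\<Sum>j\<in>{1..n} - {i}. (x i j)\<^sup>2) = row_sum n x i"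
      unfolding row_sum_def
    proof (rule sum.cong)
      fix j assume "j \<in> {1..n} - {i}"
      then have "x i j \<in> {0, 1}"
        using that by (intro graphs_entry[OF x]) auto
      then show "(x i j)\<^sup>2 = x i j"
        by auto
    qed simp
    moreover have "{l \<in> {1..n} - {i}. j < l} = {j<..n} - {i}" for j
      by auto
    ultimately show ?thesis
      using square_sum_eq[of "{1..n} - {i}" "x i"] by (simp only: row_sum_def finite_Diff finite_atLeastAtMost)
  qed
  then have "(\<Sum>i\<in>{1..n}. (row_sum n x i)\<^sup>2) = (\<Sum>i\<in>{1..n}. row_sum n x i) + 2 * two_stars n x"
    by (simp add: sum.distrib two_stars_def sum_distrib_left)
  then show ?thesis
    by (simp add: sum_row_sum_eq[OF x])
qed

lemma row_sum_spin:
  assumes "i \<in> {1..n}"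
  shows "row_sum n (spin n x) i = 2 * row_sum n x i - (real n - 1)"
proof -
  have "row_sum n (spin n x) i = (\<Sum>j\<in>{1..n} - {i}. 2 * x i j - 1)"
    unfolding row_sum_def using assms by (intro sum.cong) (auto simp: spin_def)
  also have "\<dots> = 2 * row_sum n x i - real (card ({1..n} - {i}))"
    by (simp add: sum_subtractf sum_distrib_left row_sum_def)
  also have "card ({1..n} - {i}) = n - 1"
    using assms by simp
  finally show ?thesis
    using assms by (simp add: of_nat_diff)
qed

section \<open>The Bayes identity\<close>

definition phi_density :: "nat \<Rightarrow> real \<Rightarrow> matrix \<Rightarrow> (nat \<Rightarrow> real) \<Rightarrow> real" where
  "phi_density n \<theta>\<^sub>2 y \<phi> = (\<Prod>i\<in>{1..n}.
     normal_density (row_sum n y i / (real n - 1)) (sqrt (1 / ((real n - 1) * \<theta>\<^sub>2))) (\<phi> i))"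

definition edge_factor :: "nat \<Rightarrow> real \<Rightarrow> real \<Rightarrow> (nat \<Rightarrow> real) \<Rightarrow> real" where
  "edge_factor n \<theta>\<^sub>1 \<theta>\<^sub>2 \<phi> = (\<Prod>(i, j)\<in>pairs n. exp (2 * \<theta>\<^sub>2 * (\<phi> i + \<phi> j) + 2 * \<theta>\<^sub>1) + 1)"

lemma edge_factor_pos: "edge_factor n \<theta>\<^sub>1 \<theta>\<^sub>2 \<phi> > 0"
  unfolding edge_factor_def by (intro prod_pos) (auto intro: add_pos_pos)

text \<open>
  The density of the law of \<open>\<phi>\<close>. Expanding \<open>(\<phi>\<^sub>i + 1)\<^sup>2\<close> and writing
  \<open>e\<^sup>2\<^sup>a + 1 = 2 e\<^sup>a cosh a\<close> in each edge factor, the terms linear in \<open>\<phi>\<close> cancel and the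
  familiar form proportional to \<open>exp (- (n-1)\<theta>\<^sub>2/2 \<Sum> \<phi>\<^sub>i\<^sup>2 + \<Sum> log cosh (\<theta>\<^sub>2(\<phi>\<^sub>i + \<phi>\<^sub>j) + \<theta>\<^sub>1))\<close>
  appears. The present form keeps the normalizing factor of the graph law
  visible.
\<close>

definition mixing_density :: "nat \<Rightarrow> real \<Rightarrow> real \<Rightarrow> (nat \<Rightarrow> real) \<Rightarrow> real" where
  "mixing_density n \<beta>\<^sub>1 \<beta>\<^sub>2 \<phi> =
     (1 / sqrt (2 * pi * (1 / ((real n - 1) * (\<beta>\<^sub>2 / 4))))) ^ n / partition_fun n \<beta>\<^sub>1 \<beta>\<^sub>2 *
     exp (\<Sum>i\<in>{1..n}. - ((real n - 1) * (\<beta>\<^sub>2 / 4) / 2) * (\<phi> i + 1)\<^sup>2) *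
     edge_factor n ((\<beta>\<^sub>1 + \<beta>\<^sub>2) / 2) (\<beta>\<^sub>2 / 4) \<phi>"

lemma edge_prob_alt:
  "edge_prob \<theta>\<^sub>1 \<theta>\<^sub>2 \<phi> i j =
     exp (2 * \<theta>\<^sub>2 * (\<phi> i + \<phi> j) + 2 * \<theta>\<^sub>1) / (exp (2 * \<theta>\<^sub>2 * (\<phi> i + \<phi> j) + 2 * \<theta>\<^sub>1) + 1)"
proof -
  define t where "t = \<theta>\<^sub>2 * (\<phi> i + \<phi> j) + \<theta>\<^sub>1"
  have "edge_prob \<theta>\<^sub>1 \<theta>\<^sub>2 \<phi> i j = exp t / (exp t + exp (- t))"
    by (simp add: edge_prob_def t_def algebra_simps)
  also have "\<dots> = (exp t * exp t) / ((exp t + exp (- t)) * exp t)"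
    by simp
  also have "(exp t + exp (- t)) * exp t = exp t * exp t + 1"
    by (simp add: algebra_simps flip: exp_add)
  also have "exp t * exp t = exp (2 * \<theta>\<^sub>2 * (\<phi> i + \<phi> j) + 2 * \<theta>\<^sub>1)"
    by (simp add: t_def algebra_simps flip: exp_add)
  finally show ?thesis .
qed

lemma edge_prob_bounds: "0 < edge_prob \<theta>\<^sub>1 \<theta>\<^sub>2 \<phi> i j" "edge_prob \<theta>\<^sub>1 \<theta>\<^sub>2 \<phi> i j < 1"
  by (auto simp: edge_prob_alt add_pos_pos)

text \<open>
  The inverse of \<^const>\<open>sym_of_upper\<close>; the value 0 off \<^term>\<open>pairs n\<close> is the default value of the
  product measure on the edges.
\<close>

definition upper_part :: "nat \<Rightarrow> matrix \<Rightarrow> nat \<times> nat \<Rightarrow> real" where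
  "upper_part n x = (\<lambda>p. if p \<in> pairs n then x (fst p) (snd p) else 0)"

lemma sym_of_upper_upper_part:
  assumes "x \<in> sym_matrices V n"
  shows "sym_of_upper n (upper_part n x) = x"
proof (intro ext)
  fix i j
  show "sym_of_upper n (upper_part n x) i j = x i j"
    using assms by (cases i j rule: linorder_cases)
      (auto simp: sym_matrices_def sym_of_upper_def upper_part_def pairs_def)
qed

lemma upper_part_sym_of_upper:
  assumes "\<And>p. p \<notin> pairs n \<Longrightarrow> e p = 0"
  shows "upper_part n (sym_of_upper n e) = e"
  using assms by (auto simp: upper_part_def sym_of_upper_def)

lemma sym_of_upper_in_sym_matrices:
  assumes "\<And>p. p \<in> pairs n \<Longrightarrow> e p \<in> V"
  shows "sym_of_upper n e \<in> sym_matrices V n"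
proof -
  have "i < j \<or> j < i" if "i \<noteq> j" for i j :: nat using that by auto
  then show ?thesis
    using assms by (fastforce simp: sym_matrices_def sym_of_upper_def pairs_def)
qed

lemma pmf_map_sym_of_upper:
  assumes x: "x \<in> sym_matrices V n"
  shows "pmf (map_pmf (sym_of_upper n) (Pi_pmf (pairs n) 0 q)) x = (\<Prod>(i, j)\<in>pairs n. pmf (q (i, j)) (x i j))"
proof -
  let ?P = "Pi_pmf (pairs n) 0 q"
  have supp: "e p = 0" if "e \<in> set_pmf ?P" "p \<notin> pairs n" for e p
    using set_Pi_pmf_subset[of "pairs n" 0 q] that by (cases p) auto
  have "pmf (map_pmf (sym_of_upper n) ?P) x = measure ?P (sym_of_upper n -` {x})"
    by (simp add: pmf_map)
  also have "\<dots> = measure ?P {upper_part n x}"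
    using upper_part_sym_of_upper supp sym_of_upper_upper_part[OF x]
    by (intro measure_prob_cong_0) (auto simp: set_pmf_eq)
  also have "\<dots> = pmf ?P (upper_part n x)"
    by (simp add: measure_pmf_single)
  also have "\<dots> = (\<Prod>(i, j)\<in>pairs n. pmf (q (i, j)) (x i j))"
    by (subst pmf_Pi') (auto simp: upper_part_def case_prod_unfold intro!: prod.cong)
  finally show ?thesis .
qed

lemma set_pmf_map_sym_of_upper:
  assumes "\<And>p. p \<in> pairs n \<Longrightarrow> set_pmf (q p) \<subseteq> V"
  shows "set_pmf (map_pmf (sym_of_upper n) (Pi_pmf (pairs n) 0 q)) \<subseteq> sym_matrices V n"
proof -
  have "e p \<in> V" if "e \<in> set_pmf (Pi_pmf (pairs n) 0 q)" "p \<in> pairs n" for e p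
    using set_Pi_pmf_subset'[of "pairs n" 0 q] assms[OF that(2)] that
    by (cases p) (auto simp: PiE_dflt_def)
  then show ?thesis
    by (auto intro!: sym_of_upper_in_sym_matrices)
qed

lemma set_pmf_graph_given_phi: "set_pmf (graph_given_phi n \<theta>\<^sub>1 \<theta>\<^sub>2 \<phi>) \<subseteq> graphs n"
  unfolding graph_given_phi_def graphs_def by (rule set_pmf_map_sym_of_upper) auto

lemma pmf_map_bernoulli:
  assumes "inj f" "0 \<le> p" "p \<le> 1"
  shows "pmf (map_pmf f (bernoulli_pmf p)) (f b) = (if b then p else 1 - p)"
  using assms by (simp add: pmf_map_inj')

text \<open>
  An edge variable with success probability \<open>e\<^sup>a / (e\<^sup>a + 1)\<close> takes the value \<open>t \<in> {0, 1}\<close> with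
  probability \<open>e\<^sup>t\<^sup>a / (e\<^sup>a + 1)\<close>. As \<open>a\<close> is a sum of two vertex terms, the sum of the
  exponents over the edges regroups into a sum over the vertices weighted by the degrees.
\<close>

lemma pmf_graph_given_phi:
  assumes x: "x \<in> graphs n"
  shows "pmf (graph_given_phi n \<theta>\<^sub>1 \<theta>\<^sub>2 \<phi>) x =
           exp (\<Sum>i\<in>{1..n}. row_sum n x i * (2 * \<theta>\<^sub>2 * \<phi> i + \<theta>\<^sub>1)) / edge_factor n \<theta>\<^sub>1 \<theta>\<^sub>2 \<phi>"
proof -
  define a where "a = (\<lambda>i j. 2 * \<theta>\<^sub>2 * (\<phi> i + \<phi> j) + 2 * \<theta>\<^sub>1)"
  have "pmf (graph_given_phi n \<theta>\<^sub>1 \<theta>\<^sub>2 \<phi>) x = (\<Prod>(i, j)\<in>pairs n.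
      pmf (map_pmf (\<lambda>b. if b then 1 else 0) (bernoulli_pmf (edge_prob \<theta>\<^sub>1 \<theta>\<^sub>2 \<phi> i j))) (x i j))"
    unfolding graph_given_phi_def using x
    by (subst pmf_map_sym_of_upper) (auto simp: graphs_def)
  also have "\<dots> = (\<Prod>(i, j)\<in>pairs n. exp (x i j * a i j) / (exp (a i j) + 1))"
  proof (intro prod.cong refl, clarify)
    fix i j assume ij: "(i, j) \<in> pairs n"
    define b where "b = (x i j = 1)"
    have x_eq: "x i j = (\<lambda>b. if b then 1 else 0) b"
    proof -
      have "i \<in> {1..n}" "j \<in> {1..n}" "i \<noteq> j"
        using ij by (auto simp: pairs_def)
      then have "x i j \<in> {0, 1}"
        by (intro graphs_entry[OF x])
      then show ?thesis
        by (auto simp: b_def)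
    qed
    have "pmf (map_pmf (\<lambda>b. if b then 1 else 0) (bernoulli_pmf (edge_prob \<theta>\<^sub>1 \<theta>\<^sub>2 \<phi> i j))) (x i j)
        = (if b then edge_prob \<theta>\<^sub>1 \<theta>\<^sub>2 \<phi> i j else 1 - edge_prob \<theta>\<^sub>1 \<theta>\<^sub>2 \<phi> i j)"
      unfolding x_eq using edge_prob_bounds[of \<theta>\<^sub>1 \<theta>\<^sub>2 \<phi> i j]
      by (intro pmf_map_bernoulli) (auto simp: inj_def)
    also have "\<dots> = exp (x i j * a i j) / (exp (a i j) + 1)"
    proof -
      have "exp (a i j) + 1 \<noteq> 0" by (smt (verit) exp_gt_zero)
      moreover have "edge_prob \<theta>\<^sub>1 \<theta>\<^sub>2 \<phi> i j = exp (a i j) / (exp (a i j) + 1)"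
        by (simp add: edge_prob_alt a_def)
      ultimately show ?thesis
        unfolding x_eq by (simp add: diff_divide_eq_iff)
    qed
    finally show "pmf (map_pmf (\<lambda>b. if b then 1 else 0) (bernoulli_pmf (edge_prob \<theta>\<^sub>1 \<theta>\<^sub>2 \<phi> i j))) (x i j)
        = exp (x i j * a i j) / (exp (a i j) + 1)" .
  qed
  also have "\<dots> = exp (\<Sum>(i, j)\<in>pairs n. x i j * a i j) / edge_factor n \<theta>\<^sub>1 \<theta>\<^sub>2 \<phi>"
    by (simp add: case_prod_unfold prod_dividef exp_sum edge_factor_def a_def)
  also have "(\<Sum>(i, j)\<in>pairs n. x i j * a i j) =
      (\<Sum>i\<in>{1..n}. row_sum n x i * (2 * \<theta>\<^sub>2 * \<phi> i + \<theta>\<^sub>1))"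
    by (subst sum_row_sum_mult) (auto simp: a_def algebra_simps graphs_sym[OF x])
  finally show ?thesis .
qed

text \<open>
  Both laws are images of the same independent Bernoulli variables, so facts about graphs given
  \<open>\<phi>\<close> carry over to spins.
\<close>

lemma spin_given_phi_eq:
  "spin_given_phi n \<theta>\<^sub>1 \<theta>\<^sub>2 \<phi> = map_pmf (spin n) (graph_given_phi n \<theta>\<^sub>1 \<theta>\<^sub>2 \<phi>)"
proof -
  let ?B = "Pi_pmf (pairs n) False (\<lambda>(i, j). bernoulli_pmf (edge_prob \<theta>\<^sub>1 \<theta>\<^sub>2 \<phi> i j))"
  have eq: "Pi_pmf (pairs n) 0 (\<lambda>(i, j). map_pmf f (bernoulli_pmf (edge_prob \<theta>\<^sub>1 \<theta>\<^sub>2 \<phi> i j))) =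
      map_pmf (\<lambda>h p. if p \<in> pairs n then f (h p) else 0) ?B" for f :: "bool \<Rightarrow> real"
  proof -
    have "(\<lambda>(i, j). map_pmf f (bernoulli_pmf (edge_prob \<theta>\<^sub>1 \<theta>\<^sub>2 \<phi> i j))) =
        (\<lambda>p. map_pmf f ((\<lambda>(i, j). bernoulli_pmf (edge_prob \<theta>\<^sub>1 \<theta>\<^sub>2 \<phi> i j)) p))"
      by auto
    (* The image of the default value False under f need not be 0, so the default has to be
       changed after mapping. *)
    then show ?thesis
      by (simp add: Pi_pmf_map pmf.map_comp o_def
          flip: Pi_pmf_default_swap[OF finite_pairs, where dflt = "f False" and dflt' = 0])
  qed
  have "sym_of_upper n (\<lambda>p. if p \<in> pairs n then (if h p then 1 else - 1) else 0) =
      spin n (sym_of_upper n (\<lambda>p. if p \<in> pairs n then (if h p then 1 else 0) else 0))"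
    for h :: "nat \<times> nat \<Rightarrow> bool"
  proof (intro ext)
    fix i j :: nat
    consider "i < j" | "i = j" | "j < i" by linarith
    then show "sym_of_upper n (\<lambda>p. if p \<in> pairs n then (if h p then 1 else - 1) else 0) i j =
      spin n (sym_of_upper n (\<lambda>p. if p \<in> pairs n then (if h p then 1 else 0) else 0)) i j"
      by cases (auto simp: sym_of_upper_def spin_def pairs_def)
  qed
  then show ?thesis
    unfolding spin_given_phi_def graph_given_phi_def eq by (simp add: pmf.map_comp o_def)
qed

text \<open>
  Completing the square: the quadratic terms \<open>2\<theta>\<^sub>2/(n-1) \<Sum> d\<^sub>i\<^sup>2\<close> of the model weight and of the
  Gaussian density cancel, and what remains of the dependence on \<open>x\<close> is the factor
  \<open>exp (\<Sum> d\<^sub>i (2\<theta>\<^sub>2\<phi>\<^sub>i + \<theta>\<^sub>1))\<close>, the numerator of the conditional law of the graph.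
\<close>

lemma bayes_identity:
  assumes n: "n \<ge> 2" and b: "\<beta>\<^sub>2 > 0" and x: "x \<in> graphs n"
  shows "pmf (two_star_model n \<beta>\<^sub>1 \<beta>\<^sub>2) x * phi_density n (\<beta>\<^sub>2 / 4) (spin n x) \<phi> =
     mixing_density n \<beta>\<^sub>1 \<beta>\<^sub>2 \<phi> *
     pmf (graph_given_phi n ((\<beta>\<^sub>1 + \<beta>\<^sub>2) / 2) (\<beta>\<^sub>2 / 4) \<phi>) x"
proof -
  define s where "s = real n - 1"
  define t where "t = \<beta>\<^sub>2 / 4"
  define C where "C = 1 / sqrt (2 * pi * (1 / (s * t)))"
  define d where "d = row_sum n x"
  have s: "s > 0" and t: "t > 0" using n b by (auto simp: s_def t_def)
  have gauss: "normal_density (row_sum n (spin n x) i / s) (sqrt (1 / (s * t))) (\<phi> i) =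
      C * exp (- (s * t / 2) * (\<phi> i + 1)\<^sup>2 + 2 * t * d i * (\<phi> i + 1) - 2 * t / s * (d i)\<^sup>2)"
    if "i \<in> {1..n}" for i
  proof -
    have "- (\<phi> i - row_sum n (spin n x) i / s)\<^sup>2 / (2 * (sqrt (1 / (s * t)))\<^sup>2) =
       - (s * t / 2) * (\<phi> i + 1 - 2 * d i / s)\<^sup>2"
    proof -
      have k: "row_sum n (spin n x) i = 2 * d i - s"
        using row_sum_spin[OF that, of x] by (simp add: d_def s_def)
      have "\<phi> i - (2 * d i - s) / s = \<phi> i + 1 - 2 * d i / s"
        using s by (simp add: field_simps)
      then show ?thesis
        using s t unfolding k by (simp only:) simp
    qed
    also have "\<dots> = - (s * t / 2) * (\<phi> i + 1)\<^sup>2 + 2 * t * d i * (\<phi> i + 1) - 2 * t / s * (d i)\<^sup>2"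
    proof -
      have "- (s * t / 2) * (A - 2 * D / s)\<^sup>2 = - (s * t / 2) * A\<^sup>2 + 2 * t * D * A - 2 * t / s * D\<^sup>2"
        for A D using s by (simp add: power2_eq_square field_simps)
      then show ?thesis .
    qed
    finally show ?thesis
      using s t by (simp add: normal_density_def C_def)
  qed
  have "phi_density n t (spin n x) \<phi> = (\<Prod>i\<in>{1..n}. C *
      exp (- (s * t / 2) * (\<phi> i + 1)\<^sup>2 + 2 * t * d i * (\<phi> i + 1) - 2 * t / s * (d i)\<^sup>2))"
    unfolding phi_density_def s_def[symmetric] by (intro prod.cong refl gauss)
  also have "\<dots> = C ^ n * exp (\<Sum>i\<in>{1..n}.
      - (s * t / 2) * (\<phi> i + 1)\<^sup>2 + 2 * t * d i * (\<phi> i + 1) - 2 * t / s * (d i)\<^sup>2)"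
    by (simp add: prod.distrib exp_sum)
  also have "(\<Sum>i\<in>{1..n}.
      - (s * t / 2) * (\<phi> i + 1)\<^sup>2 + 2 * t * d i * (\<phi> i + 1) - 2 * t / s * (d i)\<^sup>2) =
      (\<Sum>i\<in>{1..n}. - (s * t / 2) * (\<phi> i + 1)\<^sup>2 + d i * (2 * t * \<phi> i) + 2 * t * d i - 2 * t / s * (d i)\<^sup>2)"
    by (intro sum.cong refl) (simp add: distrib_left)
  also have "\<dots> =
      (\<Sum>i\<in>{1..n}. - (s * t / 2) * (\<phi> i + 1)\<^sup>2) + (\<Sum>i\<in>{1..n}. d i * (2 * t * \<phi> i))
      + 2 * t * (\<Sum>i\<in>{1..n}. d i) - 2 * t / s * (\<Sum>i\<in>{1..n}. (d i)\<^sup>2)"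
    by (simp only: sum.distrib sum_subtractf sum_distrib_left)
  finally have phi: "phi_density n t (spin n x) \<phi> = C ^ n * exp (
      (\<Sum>i\<in>{1..n}. - (s * t / 2) * (\<phi> i + 1)\<^sup>2) + (\<Sum>i\<in>{1..n}. d i * (2 * t * \<phi> i))
      + 2 * t * (\<Sum>i\<in>{1..n}. d i) - 2 * t / s * (\<Sum>i\<in>{1..n}. (d i)\<^sup>2))" .
  have T: "two_stars n x = (\<Sum>i\<in>{1..n}. (d i)\<^sup>2) / 2 - num_edges n x"
    using sum_row_sum_square[OF x] by (simp add: d_def add_divide_distrib)
  have E: "num_edges n x = (\<Sum>i\<in>{1..n}. d i) / 2"
    using sum_row_sum_eq[OF x] by (simp add: d_def)
  have w: "weight n \<beta>\<^sub>1 \<beta>\<^sub>2 x =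
      exp (2 * t / s * (\<Sum>i\<in>{1..n}. (d i)\<^sup>2) + \<beta>\<^sub>1 / 2 * (\<Sum>i\<in>{1..n}. d i))"
  proof -
    have "\<beta>\<^sub>2 / s * (Q / 2 - D / 2) + (\<beta>\<^sub>1 + \<beta>\<^sub>2 / s) * (D / 2) = 2 * t / s * Q + \<beta>\<^sub>1 / 2 * D" for Q D
      using s by (simp add: t_def field_simps)
    then show ?thesis
      by (simp only: weight_def s_def[symmetric] T E)
  qed
  have "weight n \<beta>\<^sub>1 \<beta>\<^sub>2 x * phi_density n t (spin n x) \<phi> = C ^ n *
      exp ((\<Sum>i\<in>{1..n}. - (s * t / 2) * (\<phi> i + 1)\<^sup>2) +
           ((\<Sum>i\<in>{1..n}. d i * (2 * t * \<phi> i)) + (\<beta>\<^sub>1 + \<beta>\<^sub>2) / 2 * (\<Sum>i\<in>{1..n}. d i)))"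
  proof -
    have "exp (u * Q + \<beta>\<^sub>1 / 2 * D) * (C ^ n * exp (H + P + 2 * t * D - u * Q)) =
        C ^ n * exp (H + (P + (\<beta>\<^sub>1 + \<beta>\<^sub>2) / 2 * D))" for u Q D H P
      by (simp add: t_def field_simps flip: exp_add)
    then show ?thesis
      by (simp only: phi w)
  qed
  also have "(\<Sum>i\<in>{1..n}. d i * (2 * t * \<phi> i)) + (\<beta>\<^sub>1 + \<beta>\<^sub>2) / 2 * (\<Sum>i\<in>{1..n}. d i) =
      (\<Sum>i\<in>{1..n}. d i * (2 * t * \<phi> i + (\<beta>\<^sub>1 + \<beta>\<^sub>2) / 2))"
    by (simp only: distrib_left sum.distrib sum_distrib_left) (simp only: mult.commute)
  finally show ?thesis
    using x edge_factor_pos[of n "(\<beta>\<^sub>1 + \<beta>\<^sub>2) / 2" t \<phi>]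
    unfolding pmf_two_star_model pmf_graph_given_phi[OF x] mixing_density_def s_def[symmetric]
      t_def[symmetric] C_def[symmetric] d_def[symmetric]
    by (simp add: exp_add)
qed

section \<open>Supports and measurability of the conditional laws\<close>

lemma set_pmf_graph_given_phi_eq: "set_pmf (graph_given_phi n \<theta>\<^sub>1 \<theta>\<^sub>2 \<phi>) = graphs n"
proof
  show "graphs n \<subseteq> set_pmf (graph_given_phi n \<theta>\<^sub>1 \<theta>\<^sub>2 \<phi>)"
    using edge_factor_pos[of n \<theta>\<^sub>1 \<theta>\<^sub>2 \<phi>] by (auto simp: set_pmf_iff pmf_graph_given_phi)
qed (rule set_pmf_graph_given_phi)

lemma spin_image_graphs: "spin n ` graphs n = spins n"
proof
  show "spin n ` graphs n \<subseteq> spins n"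
  proof
    fix y assume "y \<in> spin n ` graphs n"
    then obtain x where x: "x \<in> graphs n" and y: "y = spin n x" by auto
    show "y \<in> spins n"
      using graphs_sym[OF x] graphs_entry[OF x] by (fastforce simp: y spins_def sym_matrices_def spin_def)
  qed
  show "spins n \<subseteq> spin n ` graphs n"
  proof
    fix y assume y: "y \<in> spins n"
    define x where "x = (\<lambda>i j. if i \<in> {1..n} \<and> j \<in> {1..n} \<and> i \<noteq> j then (y i j + 1) / 2 else 0)"
    have val: "y i j \<in> {-1, 1}" if "i \<in> {1..n}" "j \<in> {1..n}" "i \<noteq> j" for i j
      using y that unfolding spins_def sym_matrices_def by blast
    have sym: "y i j = y j i" and diag: "y i i = 0"
      and out: "i \<notin> {1..n} \<or> j \<notin> {1..n} \<Longrightarrow> y i j = 0" for i j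
      using y unfolding spins_def sym_matrices_def by blast+
    have "x i j = x j i" for i j
      using sym by (simp add: x_def)
    moreover have "x i j \<in> {0, 1}" if "i \<in> {1..n}" "j \<in> {1..n}" "i \<noteq> j" for i j
      using val[OF that] that by (auto simp: x_def)
    ultimately have "x \<in> graphs n"
      unfolding graphs_def sym_matrices_def by (auto simp: x_def)
    moreover have "y = spin n x"
      using diag out by (intro ext) (auto simp: spin_def x_def add_divide_distrib)
    ultimately show "y \<in> spin n ` graphs n" by blast
  qed
qed

lemma set_pmf_spin_given_phi: "set_pmf (spin_given_phi n \<theta>\<^sub>1 \<theta>\<^sub>2 \<phi>) = spins n"
  by (simp add: spin_given_phi_eq set_pmf_graph_given_phi_eq spin_image_graphs)

text \<open>
  On an uncountable type such as \<^typ>\<open>matrix\<close>, measurability for the discrete sigma-algebra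
  does not follow from measurability of the point masses alone; a common finite support
  reduces every event to finitely many of them.
\<close>

lemma measurable_finite_pmf_kernel:
  assumes S: "finite S" and supp: "\<And>\<phi>. set_pmf (K \<phi>) \<subseteq> S"
    and meas: "\<And>z. z \<in> S \<Longrightarrow> (\<lambda>\<phi>. pmf (K \<phi>) z) \<in> borel_measurable N"
  shows "(\<lambda>\<phi>. measure_pmf (K \<phi>)) \<in> N \<rightarrow>\<^sub>M prob_algebra (count_space UNIV)"
proof (rule measurable_prob_algebraI)
  show "prob_space (measure_pmf (K \<phi>))" for \<phi>
    by (rule measure_pmf.prob_space_axioms)
  show "(\<lambda>\<phi>. measure_pmf (K \<phi>)) \<in> N \<rightarrow>\<^sub>M subprob_algebra (count_space UNIV)"
  proof (rule measurable_subprob_algebra)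
    show "subprob_space (measure_pmf (K \<phi>))" for \<phi>
      by (rule measure_pmf.subprob_space_axioms)
    show "(\<lambda>\<phi>. emeasure (measure_pmf (K \<phi>)) A) \<in> borel_measurable N" for A
    proof -
      have "emeasure (measure_pmf (K \<phi>)) A = (\<Sum>z\<in>S \<inter> A. ennreal (pmf (K \<phi>) z))" for \<phi>
      proof -
        have "emeasure (measure_pmf (K \<phi>)) A = emeasure (measure_pmf (K \<phi>)) (S \<inter> A)"
          using supp by (intro emeasure_eq_AE) (auto simp: AE_measure_pmf_iff)
        then show ?thesis
          using S by (simp add: emeasure_measure_pmf_finite)
      qed
      then show ?thesis
        using meas by simp
    qed
  qed simp
qed

lemma measurable_pmf_graph_given_phi [measurable]:
  "(\<lambda>\<phi>. pmf (graph_given_phi n \<theta>\<^sub>1 \<theta>\<^sub>2 \<phi>) x) \<in> borel_measurable (vec_space n)"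
proof (cases "x \<in> graphs n")
  case True
  have "(\<lambda>\<phi>. (\<Prod>p\<in>pairs n. exp (2 * \<theta>\<^sub>2 * (\<phi> (fst p) + \<phi> (snd p)) + 2 * \<theta>\<^sub>1) + 1))
      \<in> borel_measurable (vec_space n)"
  proof (intro borel_measurable_prod)
    fix p assume "p \<in> pairs n"
    then have [measurable]: "fst p \<in> {1..n}" "snd p \<in> {1..n}"
      by (auto simp: pairs_def)
    show "(\<lambda>\<phi>. exp (2 * \<theta>\<^sub>2 * (\<phi> (fst p) + \<phi> (snd p)) + 2 * \<theta>\<^sub>1) + 1) \<in> borel_measurable (vec_space n)"
      by measurable
  qed
  then have [measurable]: "(\<lambda>\<phi>. edge_factor n \<theta>\<^sub>1 \<theta>\<^sub>2 \<phi>) \<in> borel_measurable (vec_space n)"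
    by (simp add: edge_factor_def case_prod_unfold)
  show ?thesis
    unfolding pmf_graph_given_phi[OF True] by measurable
next
  case False
  then have "pmf (graph_given_phi n \<theta>\<^sub>1 \<theta>\<^sub>2 \<phi>) x = 0" for \<phi>
    by (simp add: pmf_eq_0_set_pmf set_pmf_graph_given_phi_eq)
  then show ?thesis
    by simp
qed

lemma measurable_graph_given_phi:
  "(\<lambda>\<phi>. measure_pmf (graph_given_phi n \<theta>\<^sub>1 \<theta>\<^sub>2 \<phi>)) \<in> vec_space n \<rightarrow>\<^sub>M prob_algebra (count_space UNIV)"
  by (rule measurable_finite_pmf_kernel[OF finite_graphs])
     (auto simp: set_pmf_graph_given_phi_eq)

lemma measurable_spin_given_phi:
  "(\<lambda>\<phi>. measure_pmf (spin_given_phi n \<theta>\<^sub>1 \<theta>\<^sub>2 \<phi>)) \<in> vec_space n \<rightarrow>\<^sub>M prob_algebra (count_space UNIV)"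
  unfolding spin_given_phi_eq map_pmf_rep_eq
  by (rule measurable_compose[OF measurable_graph_given_phi measurable_distr_prob_space]) simp

lemma measurable_phi_density [measurable]:
  "phi_density n \<theta>\<^sub>2 y \<in> borel_measurable (vec_space n)"
  unfolding phi_density_def by measurable

lemma measurable_mixing_density [measurable]:
  "mixing_density n \<beta>\<^sub>1 \<beta>\<^sub>2 \<in> borel_measurable (vec_space n)"
proof -
  (* The product of the edge factors is the reciprocal of the probability of the empty graph,
     whose measurability is already known. *)
  have "mixing_density n \<beta>\<^sub>1 \<beta>\<^sub>2 \<phi> =
     (1 / sqrt (2 * pi * (1 / ((real n - 1) * (\<beta>\<^sub>2 / 4))))) ^ n / partition_fun n \<beta>\<^sub>1 \<beta>\<^sub>2 *
     exp (\<Sum>i\<in>{1..n}. - ((real n - 1) * (\<beta>\<^sub>2 / 4) / 2) * (\<phi> i + 1)\<^sup>2) /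
     pmf (graph_given_phi n ((\<beta>\<^sub>1 + \<beta>\<^sub>2) / 2) (\<beta>\<^sub>2 / 4) \<phi>) (\<lambda>_ _. 0)" for \<phi>
  proof -
    have "(\<lambda>_ _. 0) \<in> graphs n"
      by (simp add: graphs_def sym_matrices_def)
    then show ?thesis
      by (simp add: mixing_density_def pmf_graph_given_phi row_sum_def)
  qed
  then show ?thesis
    by (simp cong: measurable_cong)
qed

lemma mixing_density_nonneg: "mixing_density n \<beta>\<^sub>1 \<beta>\<^sub>2 \<phi> \<ge> 0" if "n \<ge> 2" "\<beta>\<^sub>2 > 0"
  unfolding mixing_density_def using that edge_factor_pos partition_fun_pos
  by (intro mult_nonneg_nonneg divide_nonneg_nonneg zero_le_power) (auto intro: less_imp_le)

lemma prob_space_normal_law: "v > 0 \<Longrightarrow> prob_space (normal_law \<mu> v)"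
  unfolding normal_law_def by (rule prob_space_normal_density) simp

lemma sets_phi_given_spin [simp, measurable_cong]:
  "sets (phi_given_spin n \<theta>\<^sub>2 y) = sets (vec_space n)"
  unfolding phi_given_spin_def by (rule sets_PiM_cong) (auto simp: normal_law_def)

lemma space_phi_given_spin [simp]: "space (phi_given_spin n \<theta>\<^sub>2 y) = space (vec_space n)"
  by (rule sets_eq_imp_space_eq) simp

text \<open>
  The product of measures with densities has the product density: both sides give a box the
  product of the integrals over its sides.
\<close>

lemma phi_given_spin_eq_density:
  assumes "n \<ge> 2" "\<theta>\<^sub>2 > 0"
  shows "phi_given_spin n \<theta>\<^sub>2 y = density (PiM {1..n} (\<lambda>_. lborel)) (phi_density n \<theta>\<^sub>2 y)"
proof -
  let ?v = "1 / ((real n - 1) * \<theta>\<^sub>2)"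
  let ?L = "PiM {1..n} (\<lambda>_. lborel :: real measure)"
  define \<mu> where "\<mu> i = row_sum n y i / (real n - 1)" for i
  have v: "?v > 0" using assms by simp
  have dens: "phi_density n \<theta>\<^sub>2 y \<phi> = (\<Prod>i\<in>{1..n}. normal_density (\<mu> i) (sqrt ?v) (\<phi> i))" for \<phi>
    by (simp add: phi_density_def \<mu>_def)
  interpret N: product_sigma_finite "\<lambda>i. normal_law (\<mu> i) ?v"
    using prob_space_normal_law[OF v]
    by (auto simp: product_sigma_finite_def intro: prob_space_imp_sigma_finite)
  interpret B: product_sigma_finite "\<lambda>_. lborel :: real measure"
    by standard
  have [measurable]: "phi_density n \<theta>\<^sub>2 y \<in> borel_measurable ?L"
    unfolding phi_density_def by measurable
  have "density ?L (phi_density n \<theta>\<^sub>2 y) = PiM {1..n} (\<lambda>i. normal_law (\<mu> i) ?v)"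
  proof (rule N.PiM_eqI)
    show "sets (density ?L (phi_density n \<theta>\<^sub>2 y)) = sets (PiM {1..n} (\<lambda>i. normal_law (\<mu> i) ?v))"
      unfolding sets_density by (rule sets_PiM_cong) (auto simp: normal_law_def)
    fix A assume "\<And>i. i \<in> {1..n} \<Longrightarrow> A i \<in> sets (normal_law (\<mu> i) ?v)"
    then have A [measurable]: "\<And>i. i \<in> {1..n} \<Longrightarrow> A i \<in> sets borel"
      by (auto simp: normal_law_def)
    have "emeasure (density ?L (phi_density n \<theta>\<^sub>2 y)) (Pi\<^sub>E {1..n} A) =
        (\<integral>\<^sup>+\<phi>. ennreal (phi_density n \<theta>\<^sub>2 y \<phi>) * indicator (Pi\<^sub>E {1..n} A) \<phi> \<partial>?L)"
      using A by (intro emeasure_density sets_PiM_I_finite) auto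
    also have "\<dots> = (\<integral>\<^sup>+\<phi>. (\<Prod>i\<in>{1..n}. ennreal (normal_density (\<mu> i) (sqrt ?v) (\<phi> i)) * indicator (A i) (\<phi> i)) \<partial>?L)"
    proof (rule nn_integral_cong)
      fix \<phi> assume "\<phi> \<in> space ?L"
      then have ind: "indicator (Pi\<^sub>E {1..n} A) \<phi> = (\<Prod>i\<in>{1..n}. indicator (A i) (\<phi> i) :: ennreal)"
        by (auto simp: space_PiM PiE_def indicator_def Pi_def intro!: prod_zero)
      show "ennreal (phi_density n \<theta>\<^sub>2 y \<phi>) * indicator (Pi\<^sub>E {1..n} A) \<phi> =
        (\<Prod>i\<in>{1..n}. ennreal (normal_density (\<mu> i) (sqrt ?v) (\<phi> i)) * indicator (A i) (\<phi> i))"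
        unfolding ind dens by (simp add: prod.distrib prod_ennreal)
    qed
    also have "\<dots> = (\<Prod>i\<in>{1..n}. \<integral>\<^sup>+t. ennreal (normal_density (\<mu> i) (sqrt ?v) t) * indicator (A i) t \<partial>lborel)"
      by (rule B.product_nn_integral_prod) (auto intro!: borel_measurable_times_ennreal)
    also have "\<dots> = (\<Prod>i\<in>{1..n}. emeasure (normal_law (\<mu> i) ?v) (A i))"
      by (intro prod.cong refl) (simp add: normal_law_def emeasure_density)
    finally show "emeasure (density ?L (phi_density n \<theta>\<^sub>2 y)) (Pi\<^sub>E {1..n} A) =
      (\<Prod>i\<in>{1..n}. emeasure (normal_law (\<mu> i) ?v) (A i))" .
  qed simp
  then show ?thesis
    by (simp add: phi_given_spin_def \<mu>_def)
qed

lemma prob_space_phi_given_spin: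
  assumes "n \<ge> 2" "\<theta>\<^sub>2 > 0"
  shows "prob_space (phi_given_spin n \<theta>\<^sub>2 y)"
  unfolding phi_given_spin_def
  using assms by (intro prob_space_PiM prob_space_normal_law) simp

section \<open>Disintegration of the joint law\<close>

abbreviation joint_space :: "nat \<Rightarrow> (matrix \<times> matrix \<times> (nat \<Rightarrow> real)) measure" where
  "joint_space n \<equiv> count_space UNIV \<Otimes>\<^sub>M (count_space UNIV \<Otimes>\<^sub>M vec_space n)"

lemma measurable_joint_law_kernel:
  assumes "n \<ge> 2" "\<beta>\<^sub>2 > 0"
  shows "(\<lambda>x. distr (phi_given_spin n (\<beta>\<^sub>2 / 4) (spin n x)) (joint_space n) (\<lambda>\<phi>. (x, spin n x, \<phi>)))
     \<in> measure_pmf p \<rightarrow>\<^sub>M prob_algebra (joint_space n)"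
proof -
  have "prob_space (distr (phi_given_spin n (\<beta>\<^sub>2 / 4) (spin n x)) (joint_space n) (\<lambda>\<phi>. (x, spin n x, \<phi>)))" for x
    using assms by (intro prob_space.prob_space_distr prob_space_phi_given_spin) auto
  then show ?thesis
    by (auto simp: measurable_def space_prob_algebra)
qed

lemma prob_space_joint_law:
  assumes "n \<ge> 2" "\<beta>\<^sub>2 > 0"
  shows "prob_space (joint_law n \<beta>\<^sub>1 \<beta>\<^sub>2)"
    and sets_joint_law: "sets (joint_law n \<beta>\<^sub>1 \<beta>\<^sub>2) = sets (joint_space n)"
proof -
  have p: "measure_pmf (two_star_model n \<beta>\<^sub>1 \<beta>\<^sub>2) \<in> space (prob_algebra (measure_pmf (two_star_model n \<beta>\<^sub>1 \<beta>\<^sub>2)))"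
    by (simp add: space_prob_algebra measure_pmf.prob_space_axioms)
  note K = measurable_joint_law_kernel[OF assms]
  show "sets (joint_law n \<beta>\<^sub>1 \<beta>\<^sub>2) = sets (joint_space n)"
    unfolding joint_law_def by (rule sets_bind'[OF p K])
  show "prob_space (joint_law n \<beta>\<^sub>1 \<beta>\<^sub>2)"
    unfolding joint_law_def by (rule prob_space_bind'[OF p K])
qed

lemma nn_integral_joint_law:
  assumes "n \<ge> 2" "\<beta>\<^sub>2 > 0" and u [measurable]: "u \<in> borel_measurable (joint_space n)"
  shows "(\<integral>\<^sup>+\<omega>. u \<omega> \<partial>joint_law n \<beta>\<^sub>1 \<beta>\<^sub>2) = (\<Sum>x\<in>graphs n.
     (\<integral>\<^sup>+\<phi>. u (x, spin n x, \<phi>) \<partial>phi_given_spin n (\<beta>\<^sub>2 / 4) (spin n x)) * pmf (two_star_model n \<beta>\<^sub>1 \<beta>\<^sub>2) x)"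
proof -
  have "(\<integral>\<^sup>+\<omega>. u \<omega> \<partial>joint_law n \<beta>\<^sub>1 \<beta>\<^sub>2) = (\<integral>\<^sup>+x. \<integral>\<^sup>+\<phi>. u (x, spin n x, \<phi>)
      \<partial>phi_given_spin n (\<beta>\<^sub>2 / 4) (spin n x) \<partial>two_star_model n \<beta>\<^sub>1 \<beta>\<^sub>2)"
    unfolding joint_law_def
    by (subst nn_integral_bind[OF u measurable_prob_algebraD[OF measurable_joint_law_kernel[OF assms(1,2)]]])
       (simp add: nn_integral_distr)
  also have "\<dots> = (\<Sum>x\<in>graphs n. (\<integral>\<^sup>+\<phi>. u (x, spin n x, \<phi>)
      \<partial>phi_given_spin n (\<beta>\<^sub>2 / 4) (spin n x)) * pmf (two_star_model n \<beta>\<^sub>1 \<beta>\<^sub>2) x)"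
    by (rule nn_integral_measure_pmf_support[OF finite_graphs])
       (auto simp: set_pmf_iff pmf_two_star_model split: if_splits)
  finally show ?thesis .
qed

lemma nn_integral_graph_given_phi:
  "(\<integral>\<^sup>+x. u x \<partial>graph_given_phi n \<theta>\<^sub>1 \<theta>\<^sub>2 \<phi>) =
     (\<Sum>x\<in>graphs n. u x * pmf (graph_given_phi n \<theta>\<^sub>1 \<theta>\<^sub>2 \<phi>) x)"
  by (rule nn_integral_measure_pmf_support[OF finite_graphs])
     (auto simp: set_pmf_graph_given_phi_eq)

text \<open>
  Inserting \<open>bayes_identity\<close> under the integral turns the mixture of Gaussians over
  the graphs into a mixture of graph laws over \<open>\<phi>\<close>.
\<close>

lemma nn_integral_joint_law_mixing_density:
  assumes n: "n \<ge> 2" and b: "\<beta>\<^sub>2 > 0" and u [measurable]: "u \<in> borel_measurable (joint_space n)"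
  shows "(\<integral>\<^sup>+\<omega>. u \<omega> \<partial>joint_law n \<beta>\<^sub>1 \<beta>\<^sub>2) =
     (\<integral>\<^sup>+\<phi>. ennreal (mixing_density n \<beta>\<^sub>1 \<beta>\<^sub>2 \<phi>) *
        (\<integral>\<^sup>+x. u (x, spin n x, \<phi>) \<partial>graph_given_phi n ((\<beta>\<^sub>1 + \<beta>\<^sub>2) / 2) (\<beta>\<^sub>2 / 4) \<phi>)
        \<partial>PiM {1..n} (\<lambda>_. lborel))"
proof -
  let ?L = "PiM {1..n} (\<lambda>_. lborel :: real measure)"
  let ?p = "two_star_model n \<beta>\<^sub>1 \<beta>\<^sub>2" and ?G = "mixing_density n \<beta>\<^sub>1 \<beta>\<^sub>2"
  let ?K = "graph_given_phi n ((\<beta>\<^sub>1 + \<beta>\<^sub>2) / 2) (\<beta>\<^sub>2 / 4)"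
  have sets_L [measurable_cong]: "sets ?L = sets (vec_space n)"
    by (rule sets_PiM_cong) auto
  have "(\<integral>\<^sup>+\<phi>. u (x, spin n x, \<phi>) \<partial>phi_given_spin n (\<beta>\<^sub>2 / 4) (spin n x)) * pmf ?p x =
     (\<integral>\<^sup>+\<phi>. ennreal (?G \<phi>) * (u (x, spin n x, \<phi>) * pmf (?K \<phi>) x) \<partial>?L)" if x: "x \<in> graphs n" for x
  proof -
    have "(\<integral>\<^sup>+\<phi>. u (x, spin n x, \<phi>) \<partial>phi_given_spin n (\<beta>\<^sub>2 / 4) (spin n x)) * pmf ?p x =
      (\<integral>\<^sup>+\<phi>. ennreal (phi_density n (\<beta>\<^sub>2 / 4) (spin n x) \<phi>) * u (x, spin n x, \<phi>) \<partial>?L) * pmf ?p x"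
      using n b by (simp add: phi_given_spin_eq_density nn_integral_density)
    also have "\<dots> = (\<integral>\<^sup>+\<phi>. ennreal (phi_density n (\<beta>\<^sub>2 / 4) (spin n x) \<phi>) * u (x, spin n x, \<phi>) * pmf ?p x \<partial>?L)"
      by (rule nn_integral_multc[symmetric]) measurable
    also have "\<dots> = (\<integral>\<^sup>+\<phi>. ennreal (?G \<phi>) * (u (x, spin n x, \<phi>) * pmf (?K \<phi>) x) \<partial>?L)"
    proof (rule nn_integral_cong)
      fix \<phi>
      have "ennreal (pmf ?p x) * ennreal (phi_density n (\<beta>\<^sub>2 / 4) (spin n x) \<phi>) =
          ennreal (?G \<phi>) * ennreal (pmf (?K \<phi>) x)"
        using bayes_identity[OF n b x, of \<beta>\<^sub>1 \<phi>] mixing_density_nonneg[OF n b]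
        by (metis ennreal_mult' ennreal_mult'' pmf_nonneg)
      then show "ennreal (phi_density n (\<beta>\<^sub>2 / 4) (spin n x) \<phi>) * u (x, spin n x, \<phi>) * pmf ?p x =
          ennreal (?G \<phi>) * (u (x, spin n x, \<phi>) * pmf (?K \<phi>) x)"
        by (metis (no_types, lifting) mult.commute mult.left_commute)
    qed
    finally show ?thesis .
  qed
  then have "(\<integral>\<^sup>+\<omega>. u \<omega> \<partial>joint_law n \<beta>\<^sub>1 \<beta>\<^sub>2) =
      (\<Sum>x\<in>graphs n. \<integral>\<^sup>+\<phi>. ennreal (?G \<phi>) * (u (x, spin n x, \<phi>) * pmf (?K \<phi>) x) \<partial>?L)"
    by (simp add: nn_integral_joint_law[OF n b u])
  also have "\<dots> = (\<integral>\<^sup>+\<phi>. (\<Sum>x\<in>graphs n. ennreal (?G \<phi>) * (u (x, spin n x, \<phi>) * pmf (?K \<phi>) x)) \<partial>?L)"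
    by (rule nn_integral_sum[symmetric]) measurable
  finally show ?thesis
    by (simp add: nn_integral_graph_given_phi sum_distrib_left)
qed

text \<open>
  Averaging over the graph given \<open>\<phi>\<close> does not change the right-hand side of
  \<open>nn_integral_joint_law_mixing_density\<close>, because the average no longer depends on the graph.
\<close>

lemma joint_law_disintegration:
  assumes n: "n \<ge> 2" and b: "\<beta>\<^sub>2 > 0" and u [measurable]: "u \<in> borel_measurable (joint_space n)"
  shows "(\<integral>\<^sup>+\<omega>. u \<omega> \<partial>joint_law n \<beta>\<^sub>1 \<beta>\<^sub>2) =
     (\<integral>\<^sup>+(x, y, \<phi>). (\<integral>\<^sup>+x'. u (x', spin n x', \<phi>)
        \<partial>graph_given_phi n ((\<beta>\<^sub>1 + \<beta>\<^sub>2) / 2) (\<beta>\<^sub>2 / 4) \<phi>) \<partial>joint_law n \<beta>\<^sub>1 \<beta>\<^sub>2)"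
proof -
  let ?h = "\<lambda>\<phi>. \<integral>\<^sup>+x. u (x, spin n x, \<phi>) \<partial>graph_given_phi n ((\<beta>\<^sub>1 + \<beta>\<^sub>2) / 2) (\<beta>\<^sub>2 / 4) \<phi>"
  have "?h \<in> borel_measurable (vec_space n)"
    unfolding nn_integral_graph_given_phi by measurable
  then have "(\<lambda>\<omega>. ?h (snd (snd \<omega>))) \<in> borel_measurable (joint_space n)"
    by (rule measurable_compose[rotated]) measurable
  from nn_integral_joint_law_mixing_density[OF n b this, of \<beta>\<^sub>1]
  have "(\<integral>\<^sup>+\<omega>. ?h (snd (snd \<omega>)) \<partial>joint_law n \<beta>\<^sub>1 \<beta>\<^sub>2) =
      (\<integral>\<^sup>+\<phi>. ennreal (mixing_density n \<beta>\<^sub>1 \<beta>\<^sub>2 \<phi>) * ?h \<phi> \<partial>PiM {1..n} (\<lambda>_. lborel))"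
    by simp
  also have "\<dots> = (\<integral>\<^sup>+\<omega>. u \<omega> \<partial>joint_law n \<beta>\<^sub>1 \<beta>\<^sub>2)"
    by (rule nn_integral_joint_law_mixing_density[OF n b u, symmetric])
  finally show ?thesis
    by (simp add: case_prod_unfold)
qed

lemma nn_integral_joint_law_graph:
  assumes n: "n \<ge> 2" and b: "\<beta>\<^sub>2 > 0"
  shows "(\<integral>\<^sup>+(x, y, \<phi>). u x \<partial>joint_law n \<beta>\<^sub>1 \<beta>\<^sub>2) = (\<integral>\<^sup>+x. u x \<partial>two_star_model n \<beta>\<^sub>1 \<beta>\<^sub>2)"
proof -
  have "(\<lambda>\<omega>. u (fst \<omega>)) \<in> borel_measurable (joint_space n)"
    by (rule measurable_compose[OF measurable_fst]) simp
  then have "(\<integral>\<^sup>+(x, y, \<phi>). u x \<partial>joint_law n \<beta>\<^sub>1 \<beta>\<^sub>2) =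
      (\<Sum>x\<in>graphs n. u x * pmf (two_star_model n \<beta>\<^sub>1 \<beta>\<^sub>2) x)"
    using n b
    by (simp add: case_prod_unfold nn_integral_joint_law
        prob_space.emeasure_space_1[OF prob_space_phi_given_spin, simplified])
  also have "\<dots> = (\<integral>\<^sup>+x. u x \<partial>two_star_model n \<beta>\<^sub>1 \<beta>\<^sub>2)"
    by (rule nn_integral_measure_pmf_support[OF finite_graphs, symmetric])
       (auto simp: set_pmf_iff pmf_two_star_model split: if_splits)
  finally show ?thesis .
qed

text \<open>
  Only the disintegration over rectangles has to be checked: the sets of the sigma-algebra
  generated by \<open>Y\<close> are the preimages of the \<open>B\<close>, and the conditional expectation is determined
  by its integrals over them.
\<close>

lemma is_cond_lawI:
  assumes "prob_space M"
    and X [measurable]: "X \<in> M \<rightarrow>\<^sub>M S" and Y [measurable]: "Y \<in> M \<rightarrow>\<^sub>M N"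
    and K [measurable]: "K \<in> N \<rightarrow>\<^sub>M prob_algebra S"
    and dis: "\<And>A B. A \<in> sets S \<Longrightarrow> B \<in> sets N \<Longrightarrow>
      (\<integral>\<^sup>+\<omega>. indicator A (X \<omega>) * indicator B (Y \<omega>) \<partial>M) =
      (\<integral>\<^sup>+\<omega>. emeasure (K (Y \<omega>)) A * indicator B (Y \<omega>) \<partial>M)"
  shows "is_cond_law M X S Y N K"
  unfolding is_cond_law_def
proof (intro conjI X Y K ballI)
  fix A assume A [measurable]: "A \<in> sets S"
  interpret prob_space M by fact
  let ?F = "vimage_algebra (space M) Y N"
  let ?g = "\<lambda>\<omega>. measure (K (Y \<omega>)) A"
  have Ysp: "Y \<in> space M \<rightarrow> space N"
    using measurable_space[OF Y] by auto
  interpret finite_measure_subalgebra M ?F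
  proof
    show "subalgebra M ?F"
      unfolding subalgebra_def using Ysp measurable_sets[OF Y]
      by (auto simp: sets_vimage_algebra2)
  qed
  have K_prob: "prob_space (K (Y \<omega>))" if "\<omega> \<in> space M" for \<omega>
    using measurable_space[OF K, of "Y \<omega>"] Ysp that by (auto simp: space_prob_algebra)
  have g_le: "?g \<omega> \<le> 1" if "\<omega> \<in> space M" for \<omega>
    using prob_space.prob_le_1[OF K_prob[OF that]] .
  have K_meas: "(\<lambda>t. measure (K t) A) \<in> borel_measurable N"
    by measurable
  have g_F: "?g \<in> borel_measurable ?F"
    by (rule measurable_compose[OF measurable_vimage_algebra1[OF Ysp] K_meas])
  have [measurable]: "?g \<in> borel_measurable M"
    by (rule measurable_compose[OF Y K_meas])
  show "AE \<omega> in M. real_cond_exp M ?F (indicat_real (X -` A \<inter> space M)) \<omega> = ?g \<omega>"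
  proof (rule real_cond_exp_charact)
    show "integrable M ?g"
      using g_le by (intro integrable_const_bound[of _ 1]) auto
    show "integrable M (indicat_real (X -` A \<inter> space M))"
      by (intro integrable_const_bound[of _ 1]) auto
    fix C assume "C \<in> sets ?F"
    then obtain B where B [measurable]: "B \<in> sets N" and C: "C = Y -` B \<inter> space M"
      using Ysp by (auto simp: sets_vimage_algebra2)
    have [measurable]: "C \<in> sets M"
      unfolding C by measurable
    have "(\<integral>\<^sup>+\<omega>. ennreal (indicator C \<omega> * indicat_real (X -` A \<inter> space M) \<omega>) \<partial>M) =
        (\<integral>\<^sup>+\<omega>. indicator A (X \<omega>) * indicator B (Y \<omega>) \<partial>M)"
      by (intro nn_integral_cong) (auto simp: C indicator_def)
    also have "\<dots> = (\<integral>\<^sup>+\<omega>. emeasure (K (Y \<omega>)) A * indicator B (Y \<omega>) \<partial>M)"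
      by (rule dis[OF A B])
    also have "\<dots> = (\<integral>\<^sup>+\<omega>. ennreal (indicator C \<omega> * ?g \<omega>) \<partial>M)"
    proof (rule nn_integral_cong)
      fix \<omega> assume "\<omega> \<in> space M"
      then interpret K\<omega>: prob_space "K (Y \<omega>)"
        by (rule K_prob)
      show "emeasure (K (Y \<omega>)) A * indicator B (Y \<omega>) = ennreal (indicator C \<omega> * ?g \<omega>)"
        using \<open>\<omega> \<in> space M\<close> by (auto simp: C indicator_def K\<omega>.emeasure_eq_measure)
    qed
    finally have eq: "(\<integral>\<^sup>+\<omega>. ennreal (indicator C \<omega> * indicat_real (X -` A \<inter> space M) \<omega>) \<partial>M) =
        (\<integral>\<^sup>+\<omega>. ennreal (indicator C \<omega> * ?g \<omega>) \<partial>M)" .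
    show "(LINT \<omega>:C|M. indicat_real (X -` A \<inter> space M) \<omega>) = (LINT \<omega>:C|M. ?g \<omega>)"
      unfolding set_lebesgue_integral_def
      by (subst (1 2) integral_eq_nn_integral) (auto simp: eq)
  qed (rule g_F)
qed

lemma is_cond_law_joint_law:
  assumes n: "n \<ge> 2" and b: "\<beta>\<^sub>2 > 0"
  shows "is_cond_law (joint_law n \<beta>\<^sub>1 \<beta>\<^sub>2)
     (\<lambda>(x, y, \<phi>). x) (count_space UNIV) (\<lambda>(x, y, \<phi>). \<phi>) (vec_space n)
     (\<lambda>\<phi>. measure_pmf (graph_given_phi n ((\<beta>\<^sub>1 + \<beta>\<^sub>2) / 2) (\<beta>\<^sub>2 / 4) \<phi>))"
proof (rule is_cond_lawI[OF prob_space_joint_law(1)[OF n b] _ _ measurable_graph_given_phi])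
  note [measurable_cong] = sets_joint_law[OF n b]
  show "(\<lambda>(x, y, \<phi>). x) \<in> joint_law n \<beta>\<^sub>1 \<beta>\<^sub>2 \<rightarrow>\<^sub>M count_space UNIV" by measurable
  show "(\<lambda>(x, y, \<phi>). \<phi>) \<in> joint_law n \<beta>\<^sub>1 \<beta>\<^sub>2 \<rightarrow>\<^sub>M vec_space n" by measurable
  fix A :: "matrix set" and B assume [measurable]: "B \<in> sets (vec_space n)"
  have [measurable]: "(\<lambda>\<omega>. indicator A (fst \<omega>)) \<in> borel_measurable (joint_space n)"
    by (rule measurable_compose[OF measurable_fst]) simp
  have "(\<lambda>\<omega>. indicator A (fst \<omega>) * indicator B (snd (snd \<omega>)) :: ennreal) \<in> borel_measurable (joint_space n)"
    by measurable
  from joint_law_disintegration[OF n b this, of \<beta>\<^sub>1]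
  show "(\<integral>\<^sup>+\<omega>. indicator A (case \<omega> of (x, y, \<phi>) \<Rightarrow> x) * indicator B (case \<omega> of (x, y, \<phi>) \<Rightarrow> \<phi>) \<partial>joint_law n \<beta>\<^sub>1 \<beta>\<^sub>2) =
    (\<integral>\<^sup>+\<omega>. emeasure (measure_pmf (graph_given_phi n ((\<beta>\<^sub>1 + \<beta>\<^sub>2) / 2) (\<beta>\<^sub>2 / 4) (case \<omega> of (x, y, \<phi>) \<Rightarrow> \<phi>))) A
        * indicator B (case \<omega> of (x, y, \<phi>) \<Rightarrow> \<phi>) \<partial>joint_law n \<beta>\<^sub>1 \<beta>\<^sub>2)"
    by (simp add: case_prod_unfold nn_integral_multc)
qed

lemma phi_law_bind_graph_given_phi:
  assumes n: "n \<ge> 2" and b: "\<beta>\<^sub>2 > 0"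
  shows "phi_law n \<beta>\<^sub>1 \<beta>\<^sub>2 \<bind> (\<lambda>\<phi>. measure_pmf (graph_given_phi n ((\<beta>\<^sub>1 + \<beta>\<^sub>2) / 2) (\<beta>\<^sub>2 / 4) \<phi>)) =
    measure_pmf (two_star_model n \<beta>\<^sub>1 \<beta>\<^sub>2)"
proof -
  let ?K = "\<lambda>\<phi>. measure_pmf (graph_given_phi n ((\<beta>\<^sub>1 + \<beta>\<^sub>2) / 2) (\<beta>\<^sub>2 / 4) \<phi>)"
  note [measurable_cong] = sets_joint_law[OF n b]
  have [measurable]: "(\<lambda>(x, y, \<phi>). \<phi>) \<in> joint_law n \<beta>\<^sub>1 \<beta>\<^sub>2 \<rightarrow>\<^sub>M vec_space n"
    by measurable
  have F: "phi_law n \<beta>\<^sub>1 \<beta>\<^sub>2 \<in> space (prob_algebra (vec_space n))"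
    unfolding space_prob_algebra phi_law_def
    by (auto intro!: prob_space.prob_space_distr prob_space_joint_law[OF n b])
  note K = measurable_graph_given_phi[of n "(\<beta>\<^sub>1 + \<beta>\<^sub>2) / 2" "\<beta>\<^sub>2 / 4"]
  show ?thesis
  proof (rule measure_eqI)
    show "sets (phi_law n \<beta>\<^sub>1 \<beta>\<^sub>2 \<bind> ?K) = sets (measure_pmf (two_star_model n \<beta>\<^sub>1 \<beta>\<^sub>2))"
      using sets_bind'[OF F K] by simp
    fix A
    have [measurable]: "(\<lambda>\<phi>. emeasure (?K \<phi>) A) \<in> borel_measurable (vec_space n)"
      using measurable_prob_algebraD[OF K] by (rule measurable_emeasure_kernel) simp
    have "emeasure (phi_law n \<beta>\<^sub>1 \<beta>\<^sub>2 \<bind> ?K) A = (\<integral>\<^sup>+\<phi>. emeasure (?K \<phi>) A \<partial>phi_law n \<beta>\<^sub>1 \<beta>\<^sub>2)"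
      by (rule emeasure_bind_prob_algebra[OF F K]) simp
    also have "\<dots> = (\<integral>\<^sup>+(x, y, \<phi>). emeasure (?K \<phi>) A \<partial>joint_law n \<beta>\<^sub>1 \<beta>\<^sub>2)"
      unfolding phi_law_def by (subst nn_integral_distr) (auto simp: case_prod_unfold)
    also have "\<dots> = (\<integral>\<^sup>+(x, y, \<phi>). indicator A x \<partial>joint_law n \<beta>\<^sub>1 \<beta>\<^sub>2)"
    proof -
      have "(\<lambda>\<omega>. indicator A (fst \<omega>) :: ennreal) \<in> borel_measurable (joint_space n)"
        by (rule measurable_compose[OF measurable_fst]) simp
      from joint_law_disintegration[OF n b this, of \<beta>\<^sub>1] show ?thesis
        by (simp add: case_prod_unfold)
    qed
    also have "\<dots> = emeasure (measure_pmf (two_star_model n \<beta>\<^sub>1 \<beta>\<^sub>2)) A"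
      by (simp add: nn_integral_joint_law_graph[OF n b])
    finally show "emeasure (phi_law n \<beta>\<^sub>1 \<beta>\<^sub>2 \<bind> ?K) A = emeasure (measure_pmf (two_star_model n \<beta>\<^sub>1 \<beta>\<^sub>2)) A" .
  qed
qed

section \<open>One step of the Gibbs sampler\<close>

lemma finite_support_measure_is_pmf:
  assumes "prob_space M" and sets: "sets M = UNIV" and S: "finite S" "AE x in M. x \<in> S"
  shows "\<exists>p. M = measure_pmf p"
proof -
  interpret prob_space M by fact
  have null: "AE x in M. x \<noteq> z" if "measure M {z} = 0" for z
    by (rule AE_I[of _ _ "{z}"]) (use that sets in \<open>auto simp: emeasure_eq_measure\<close>)
  have "AE x in M. \<forall>z\<in>{z \<in> S. measure M {z} = 0}. x \<noteq> z"
    using S(1) null by (subst AE_ball_countable) (auto intro: countable_finite)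
  with S(2) have "AE x in M. measure M {x} \<noteq> 0"
    by eventually_elim auto
  then have "M \<in> {M. prob_space M \<and> sets M = UNIV \<and> (AE x in M. measure M {x} \<noteq> 0)}"
    using sets prob_space_axioms by auto
  then show ?thesis
    by (intro exI[of _ "Abs_pmf M"]) (simp add: Abs_pmf_inverse)
qed

text \<open>
  The sampler is a Markov kernel of discrete laws. It charges every spin matrix, from
  every starting point, because the probability of a given matrix under \<^const>\<open>spin_given_phi\<close> is
  positive for every \<open>\<phi>\<close> and hence has a positive integral.
\<close>

lemma gibbs_step_kernel:
  assumes n: "n \<ge> 2" and t: "\<theta>\<^sub>2 > 0"
  obtains Q where "gibbs_step n \<theta>\<^sub>1 \<theta>\<^sub>2 = (\<lambda>y. measure_pmf (Q y))"
    and "\<And>y A. emeasure (measure_pmf (Q y)) A =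
      (\<integral>\<^sup>+\<phi>. emeasure (measure_pmf (spin_given_phi n \<theta>\<^sub>1 \<theta>\<^sub>2 \<phi>)) A \<partial>phi_given_spin n \<theta>\<^sub>2 y)"
    and "\<And>y. set_pmf (Q y) = spins n"
proof -
  let ?K = "\<lambda>\<phi>. measure_pmf (spin_given_phi n \<theta>\<^sub>1 \<theta>\<^sub>2 \<phi>)"
  have F: "phi_given_spin n \<theta>\<^sub>2 y \<in> space (prob_algebra (vec_space n))" for y
    by (simp add: space_prob_algebra prob_space_phi_given_spin[OF n t])
  note K = measurable_spin_given_phi[of n \<theta>\<^sub>1 \<theta>\<^sub>2]
  have meas: "(\<lambda>\<phi>. emeasure (?K \<phi>) A) \<in> borel_measurable (vec_space n)" for A
    using measurable_prob_algebraD[OF K] by (rule measurable_emeasure_kernel) simp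
  have em: "emeasure (gibbs_step n \<theta>\<^sub>1 \<theta>\<^sub>2 y) A =
      (\<integral>\<^sup>+\<phi>. emeasure (?K \<phi>) A \<partial>phi_given_spin n \<theta>\<^sub>2 y)" for y A
    unfolding gibbs_step_def by (rule emeasure_bind_prob_algebra[OF F K]) simp
  have sets: "sets (gibbs_step n \<theta>\<^sub>1 \<theta>\<^sub>2 y) = UNIV" for y
    unfolding gibbs_step_def using sets_bind'[OF F K] by simp
  have ps: "prob_space (gibbs_step n \<theta>\<^sub>1 \<theta>\<^sub>2 y)" for y
    unfolding gibbs_step_def by (rule prob_space_bind'[OF F K])
  have fin: "finite (spins n)"
    by (simp add: spins_def finite_sym_matrices)
  have "\<exists>p. gibbs_step n \<theta>\<^sub>1 \<theta>\<^sub>2 y = measure_pmf p" for y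
  proof (rule finite_support_measure_is_pmf[OF ps sets fin])
    have "emeasure (?K \<phi>) (- spins n) = 0" for \<phi>
      using set_pmf_spin_given_phi[of n \<theta>\<^sub>1 \<theta>\<^sub>2 \<phi>]
      by (auto simp: measure_pmf.emeasure_eq_measure measure_pmf_zero_iff)
    then have "emeasure (gibbs_step n \<theta>\<^sub>1 \<theta>\<^sub>2 y) (- spins n) = 0"
      by (simp add: em)
    then show "AE x in gibbs_step n \<theta>\<^sub>1 \<theta>\<^sub>2 y. x \<in> spins n"
      by (intro AE_I[of _ _ "- spins n"]) (auto simp: sets)
  qed
  then obtain Q where Q: "\<And>y. gibbs_step n \<theta>\<^sub>1 \<theta>\<^sub>2 y = measure_pmf (Q y)"
    by metis
  have "z \<in> set_pmf (Q y) \<longleftrightarrow> z \<in> spins n" for y z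
  proof -
    interpret P: prob_space "phi_given_spin n \<theta>\<^sub>2 y"
      by (rule prob_space_phi_given_spin[OF n t])
    have m: "(\<lambda>\<phi>. emeasure (?K \<phi>) {z}) \<in> borel_measurable (phi_given_spin n \<theta>\<^sub>2 y)"
      using meas by (simp cong: measurable_cong_sets)
    have zero: "emeasure (?K \<phi>) {z} = 0 \<longleftrightarrow> z \<notin> spins n" for \<phi>
      using set_pmf_spin_given_phi[of n \<theta>\<^sub>1 \<theta>\<^sub>2 \<phi>] by (auto simp: emeasure_pmf_single set_pmf_iff)
    have "z \<notin> set_pmf (Q y) \<longleftrightarrow> emeasure (gibbs_step n \<theta>\<^sub>1 \<theta>\<^sub>2 y) {z} = 0"
      by (simp add: Q emeasure_pmf_single set_pmf_iff)
    also have "\<dots> \<longleftrightarrow> (AE \<phi> in phi_given_spin n \<theta>\<^sub>2 y. emeasure (?K \<phi>) {z} = 0)"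
      unfolding em by (rule nn_integral_0_iff_AE[OF m])
    also have "\<dots> \<longleftrightarrow> z \<notin> spins n"
      by (simp add: zero)
    finally show ?thesis by blast
  qed
  then show thesis
    using that[of Q] Q em by (auto simp: fun_eq_iff)
qed

text \<open>
  Started from the two star model, the first half of a step produces the joint law of \<open>x\<close> and
  \<open>\<phi>\<close>; by \<open>joint_law_disintegration\<close> the second half, which resamples the graph given
  \<open>\<phi>\<close>, leaves the law of the graph, and so that of the spin matrix, unchanged.
\<close>

lemma gibbs_stationary:
  assumes n: "n \<ge> 2" and b: "\<beta>\<^sub>2 > 0"
    and Q: "\<And>y A. emeasure (measure_pmf (Q y)) A = (\<integral>\<^sup>+\<phi>. emeasure (measure_pmf
        (spin_given_phi n ((\<beta>\<^sub>1 + \<beta>\<^sub>2) / 2) (\<beta>\<^sub>2 / 4) \<phi>)) A \<partial>phi_given_spin n (\<beta>\<^sub>2 / 4) y)"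
  shows "bind_pmf (map_pmf (spin n) (two_star_model n \<beta>\<^sub>1 \<beta>\<^sub>2)) Q = map_pmf (spin n) (two_star_model n \<beta>\<^sub>1 \<beta>\<^sub>2)"
proof (rule pmf_eqI)
  fix z
  let ?p = "two_star_model n \<beta>\<^sub>1 \<beta>\<^sub>2" and ?A = "spin n -` {z}"
  let ?K = "graph_given_phi n ((\<beta>\<^sub>1 + \<beta>\<^sub>2) / 2) (\<beta>\<^sub>2 / 4)"
  have m: "(\<lambda>\<phi>. emeasure (measure_pmf (?K \<phi>)) ?A) \<in> borel_measurable (vec_space n)"
    using measurable_prob_algebraD[OF measurable_graph_given_phi] by (rule measurable_emeasure_kernel) simp
  have m1: "(\<lambda>\<omega>. emeasure (measure_pmf (?K (snd (snd \<omega>)))) ?A) \<in> borel_measurable (joint_space n)"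
    by (rule measurable_compose[OF _ m]) measurable
  have m2: "(\<lambda>\<omega>. indicator ?A (fst \<omega>) :: ennreal) \<in> borel_measurable (joint_space n)"
    by (rule measurable_compose[OF measurable_fst]) simp
  have "ennreal (pmf (bind_pmf (map_pmf (spin n) ?p) Q) z) =
      (\<integral>\<^sup>+x. emeasure (measure_pmf (Q (spin n x))) {z} \<partial>?p)"
    by (simp add: ennreal_pmf_bind emeasure_pmf_single)
  also have "\<dots> = (\<integral>\<^sup>+x. (\<integral>\<^sup>+\<phi>. emeasure (measure_pmf (?K \<phi>)) ?A \<partial>phi_given_spin n (\<beta>\<^sub>2 / 4) (spin n x)) \<partial>?p)"
    by (simp add: Q spin_given_phi_eq)
  also have "\<dots> = (\<Sum>x\<in>graphs n. (\<integral>\<^sup>+\<phi>. emeasure (measure_pmf (?K \<phi>)) ?A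
      \<partial>phi_given_spin n (\<beta>\<^sub>2 / 4) (spin n x)) * pmf ?p x)"
    by (rule nn_integral_measure_pmf_support[OF finite_graphs])
       (auto simp: set_pmf_iff pmf_two_star_model split: if_splits)
  also have "\<dots> = (\<integral>\<^sup>+\<omega>. emeasure (measure_pmf (?K (snd (snd \<omega>)))) ?A \<partial>joint_law n \<beta>\<^sub>1 \<beta>\<^sub>2)"
    by (simp add: nn_integral_joint_law[OF n b m1])
  also have "\<dots> = (\<integral>\<^sup>+\<omega>. indicator ?A (fst \<omega>) \<partial>joint_law n \<beta>\<^sub>1 \<beta>\<^sub>2)"
    using joint_law_disintegration[OF n b m2, of \<beta>\<^sub>1] by (simp add: case_prod_unfold)
  also have "\<dots> = emeasure (measure_pmf ?p) ?A"
    using nn_integral_joint_law_graph[OF n b, where u = "indicator ?A"] by (simp add: case_prod_unfold)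
  also have "\<dots> = ennreal (pmf (map_pmf (spin n) ?p) z)"
    by (simp add: ennreal_pmf_map)
  finally show "pmf (bind_pmf (map_pmf (spin n) ?p) Q) z = pmf (map_pmf (spin n) ?p) z"
    by simp
qed

lemma gibbs_law_eq:
  assumes "gibbs_step n \<theta>\<^sub>1 \<theta>\<^sub>2 = (\<lambda>y. measure_pmf (Q y))"
  shows "gibbs_law n \<theta>\<^sub>1 \<theta>\<^sub>2 y\<^sub>0 l = measure_pmf (((\<lambda>p. bind_pmf p Q) ^^ l) (return_pmf y\<^sub>0))"
  by (induction l) (simp_all add: assms measure_pmf_bind return_pmf.rep_eq)

section \<open>Convergence of finite Markov chains with positive transitions\<close>

lemma tv_dist_pmf_le:
  assumes "finite S" "set_pmf p \<subseteq> S" "set_pmf q \<subseteq> S"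
  shows "0 \<le> tv_dist p q" and "tv_dist p q \<le> (\<Sum>z\<in>S. \<bar>pmf p z - pmf q z\<bar>)"
proof -
  have le: "\<bar>measure p A - measure q A\<bar> \<le> (\<Sum>z\<in>S. \<bar>pmf p z - pmf q z\<bar>)" for A
  proof -
    have "measure r A = (\<Sum>z\<in>A \<inter> S. pmf r z)" if "set_pmf r \<subseteq> S" for r
    proof -
      have "measure r A = measure r (A \<inter> S)"
        using that by (intro measure_prob_cong_0) (auto simp: set_pmf_eq)
      then show ?thesis using assms by (simp add: measure_measure_pmf_finite)
    qed
    then have "\<bar>measure p A - measure q A\<bar> = \<bar>\<Sum>z\<in>A \<inter> S. pmf p z - pmf q z\<bar>"
      using assms by (simp add: sum_subtractf)
    also have "\<dots> \<le> (\<Sum>z\<in>A \<inter> S. \<bar>pmf p z - pmf q z\<bar>)"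
      by (rule sum_abs)
    also have "\<dots> \<le> (\<Sum>z\<in>S. \<bar>pmf p z - pmf q z\<bar>)"
      using assms by (intro sum_mono2) auto
    finally show ?thesis .
  qed
  show "tv_dist p q \<le> (\<Sum>z\<in>S. \<bar>pmf p z - pmf q z\<bar>)"
    unfolding tv_dist_def using le by (intro cSUP_least) auto
  have "bdd_above ((\<lambda>A. \<bar>measure p A - measure q A\<bar>) ` sets p)"
    using le by (auto intro!: bdd_aboveI)
  then have "\<bar>measure p {} - measure q {}\<bar> \<le> tv_dist p q"
    unfolding tv_dist_def by (intro cSUP_upper) auto
  then show "0 \<le> tv_dist p q" by simp
qed

lemma pmf_bind_finite:
  assumes "finite S" "set_pmf p \<subseteq> S"
  shows "pmf (bind_pmf p Q) z = (\<Sum>y\<in>S. pmf p y * pmf (Q y) z)"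
  using assms by (subst pmf_bind, subst integral_measure_pmf[of S]) auto

text \<open>
  Doeblin's argument. The difference of two probability vectors has total mass 0, so a
  constant \<open>\<delta>\<close> may be subtracted from all entries of the kernel without changing its action on the
  difference; when \<open>\<delta>\<close> is a lower bound of the entries, the result is a nonnegative kernel
  of total mass \<open>1 - card S * \<delta>\<close> in each row.
\<close>

lemma positive_kernel_contraction:
  fixes Q :: "'a \<Rightarrow> 'a pmf" and \<delta> :: real
  assumes S: "finite S" and supp: "set_pmf p \<subseteq> S" "set_pmf q \<subseteq> S"
    and Q: "\<And>y. y \<in> S \<Longrightarrow> set_pmf (Q y) \<subseteq> S"
    and \<delta>: "\<And>y z. y \<in> S \<Longrightarrow> z \<in> S \<Longrightarrow> \<delta> \<le> pmf (Q y) z"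
  shows "(\<Sum>z\<in>S. \<bar>pmf (bind_pmf p Q) z - pmf (bind_pmf q Q) z\<bar>) \<le>
           (1 - card S * \<delta>) * (\<Sum>z\<in>S. \<bar>pmf p z - pmf q z\<bar>)"
proof -
  have tot: "(\<Sum>y\<in>S. pmf p y - pmf q y) = 0"
    using S supp by (simp add: sum_subtractf sum_pmf_eq_1)
  have "\<bar>pmf (bind_pmf p Q) z - pmf (bind_pmf q Q) z\<bar> \<le>
      (\<Sum>y\<in>S. \<bar>pmf p y - pmf q y\<bar> * (pmf (Q y) z - \<delta>))" if "z \<in> S" for z
  proof -
    have "pmf (bind_pmf p Q) z - pmf (bind_pmf q Q) z =
        (\<Sum>y\<in>S. (pmf p y - pmf q y) * pmf (Q y) z)"
      using S supp by (simp add: pmf_bind_finite algebra_simps sum_subtractf)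
    also have "\<dots> = (\<Sum>y\<in>S. (pmf p y - pmf q y) * (pmf (Q y) z - \<delta>))"
      using tot by (simp add: right_diff_distrib sum_subtractf flip: sum_distrib_right)
    also have "\<bar>\<dots>\<bar> \<le> (\<Sum>y\<in>S. \<bar>(pmf p y - pmf q y) * (pmf (Q y) z - \<delta>)\<bar>)"
      by (rule sum_abs)
    also have "\<dots> = (\<Sum>y\<in>S. \<bar>pmf p y - pmf q y\<bar> * (pmf (Q y) z - \<delta>))"
      using \<delta> that by (intro sum.cong) (auto simp: abs_mult)
    finally show ?thesis .
  qed
  then have "(\<Sum>z\<in>S. \<bar>pmf (bind_pmf p Q) z - pmf (bind_pmf q Q) z\<bar>) \<le>
      (\<Sum>z\<in>S. \<Sum>y\<in>S. \<bar>pmf p y - pmf q y\<bar> * (pmf (Q y) z - \<delta>))"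
    by (rule sum_mono)
  also have "\<dots> = (\<Sum>y\<in>S. \<bar>pmf p y - pmf q y\<bar> * (\<Sum>z\<in>S. pmf (Q y) z - \<delta>))"
    by (subst sum.swap) (simp add: sum_distrib_left)
  also have "\<dots> = (\<Sum>y\<in>S. \<bar>pmf p y - pmf q y\<bar> * (1 - card S * \<delta>))"
    using S Q by (intro sum.cong) (auto simp: sum_subtractf sum_pmf_eq_1)
  finally show ?thesis
    by (simp add: sum_distrib_left mult.commute)
qed

lemma positive_finite_chain_converges:
  fixes Q :: "'a \<Rightarrow> 'a pmf"
  assumes S: "finite S" and Q: "\<And>y. y \<in> S \<Longrightarrow> set_pmf (Q y) = S"
    and \<pi>: "set_pmf \<pi> \<subseteq> S" "bind_pmf \<pi> Q = \<pi>" and \<mu>: "set_pmf \<mu> \<subseteq> S"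
  shows "(\<lambda>l. tv_dist (((\<lambda>p. bind_pmf p Q) ^^ l) \<mu>) \<pi>) \<longlonglongrightarrow> 0"
proof -
  define law where "law l = ((\<lambda>p. bind_pmf p Q) ^^ l) \<mu>" for l
  define D where "D l = (\<Sum>z\<in>S. \<bar>pmf (law l) z - pmf \<pi> z\<bar>)" for l
  define \<delta> where "\<delta> = Min ((\<lambda>(y, z). pmf (Q y) z) ` (S \<times> S))"
  define r where "r = 1 - card S * \<delta>"
  have "S \<noteq> {}" using \<pi>(1) set_pmf_not_empty[of \<pi>] by auto
  have "\<delta> > 0"
    unfolding \<delta>_def using S \<open>S \<noteq> {}\<close> Q by (subst Min_gr_iff) (auto simp: pmf_positive)
  have \<delta>_le: "\<delta> \<le> pmf (Q y) z" if "y \<in> S" "z \<in> S" for y z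
    unfolding \<delta>_def using S that by (intro Min_le) (auto intro: rev_image_eqI)
  have "r < 1"
    using \<open>\<delta> > 0\<close> S \<open>S \<noteq> {}\<close> by (simp add: r_def card_gt_0_iff)
  have "r \<ge> 0"
  proof -
    obtain y where "y \<in> S" using \<open>S \<noteq> {}\<close> by auto
    have "card S * \<delta> = (\<Sum>z\<in>S. \<delta>)" by simp
    also have "\<dots> \<le> (\<Sum>z\<in>S. pmf (Q y) z)"
      using \<delta>_le \<open>y \<in> S\<close> by (intro sum_mono) auto
    also have "\<dots> = 1"
      using S Q \<open>y \<in> S\<close> by (intro sum_pmf_eq_1) auto
    finally show ?thesis by (simp add: r_def)
  qed
  have supp: "set_pmf (law l) \<subseteq> S" for l
    by (induction l) (use \<mu> Q in \<open>auto simp: law_def\<close>)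
  have "D (Suc l) \<le> r * D l" for l
    using positive_kernel_contraction[OF S supp \<pi>(1), of Q \<delta>] Q \<delta>_le \<pi>(2)
    by (simp add: D_def r_def law_def)
  then have "D l \<le> r ^ l * D 0" for l
  proof (induction l)
    case (Suc l)
    have "D (Suc l) \<le> r * D l" by fact
    also have "\<dots> \<le> r * (r ^ l * D 0)"
      using Suc \<open>r \<ge> 0\<close> by (intro mult_left_mono) auto
    finally show ?case by (simp add: mult_ac)
  qed auto
  then have upper: "tv_dist (law l) \<pi> \<le> r ^ l * D 0" for l
    using tv_dist_pmf_le(2)[OF S supp \<pi>(1)] by (metis D_def order_trans)
  have lim: "(\<lambda>l. r ^ l * D 0) \<longlonglongrightarrow> 0"
    using \<open>r \<ge> 0\<close> \<open>r < 1\<close> by (intro tendsto_mult_left_zero LIMSEQ_realpow_zero) auto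
  have "(\<lambda>l. tv_dist (law l) \<pi>) \<longlonglongrightarrow> 0"
    by (rule tendsto_sandwich[OF _ _ tendsto_const lim])
       (use tv_dist_pmf_le(1)[OF S supp \<pi>(1)] upper in auto)
  then show ?thesis by (simp add: law_def)
qed

section \<open>Mixture representation and convergence of the Gibbs sampler\<close>

theorem theorem2p3:
  fixes n :: nat and \<beta>\<^sub>1 \<beta>\<^sub>2 \<theta>\<^sub>1 \<theta>\<^sub>2 :: real
  assumes "n \<ge> 2" and "\<beta>\<^sub>2 > 0"
    and "\<theta>\<^sub>2 = \<beta>\<^sub>2 / 4" and "\<theta>\<^sub>1 = (\<beta>\<^sub>1 + \<beta>\<^sub>2) / 2"
  shows
    "(\<forall>\<phi> i j. edge_prob \<theta>\<^sub>1 \<theta>\<^sub>2 \<phi> i j =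
        exp (2 * \<theta>\<^sub>2 * (\<phi> i + \<phi> j) + 2 * \<theta>\<^sub>1) / (exp (2 * \<theta>\<^sub>2 * (\<phi> i + \<phi> j) + 2 * \<theta>\<^sub>1) + 1))
     \<and> phi_law n \<beta>\<^sub>1 \<beta>\<^sub>2 \<bind> (\<lambda>\<phi>. measure_pmf (graph_given_phi n \<theta>\<^sub>1 \<theta>\<^sub>2 \<phi>))
        = measure_pmf (two_star_model n \<beta>\<^sub>1 \<beta>\<^sub>2)
     \<and> is_cond_law (joint_law n \<beta>\<^sub>1 \<beta>\<^sub>2)
         (\<lambda>(x, y, \<phi>). x) (count_space UNIV)
         (\<lambda>(x, y, \<phi>). \<phi>) (vec_space n)
         (\<lambda>\<phi>. measure_pmf (graph_given_phi n \<theta>\<^sub>1 \<theta>\<^sub>2 \<phi>))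
     \<and> (\<forall>\<phi>\<in>space (vec_space n). \<forall>x\<in>graphs n.
          pmf (graph_given_phi n \<theta>\<^sub>1 \<theta>\<^sub>2 \<phi>) x =
            exp (\<Sum>i\<in>{1..n}. row_sum n x i * (2 * \<theta>\<^sub>2 * \<phi> i + \<theta>\<^sub>1)) /
            (\<Prod>(i, j)\<in>pairs n. (exp (2 * \<theta>\<^sub>2 * (\<phi> i + \<phi> j) + 2 * \<theta>\<^sub>1) + 1)))
     \<and> (\<forall>y\<^sub>0\<in>spins n.
          (\<lambda>l. tv_dist (gibbs_law n \<theta>\<^sub>1 \<theta>\<^sub>2 y\<^sub>0 l)
                 (measure_pmf (map_pmf (spin n) (two_star_model n \<beta>\<^sub>1 \<beta>\<^sub>2))))
          \<longlonglongrightarrow> 0)"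
proof -
  note n = assms(1) and b = assms(2)
  have t: "\<theta>\<^sub>2 > 0" using assms by simp
  have \<theta>: "(\<beta>\<^sub>1 + \<beta>\<^sub>2) / 2 = \<theta>\<^sub>1" "\<beta>\<^sub>2 / 4 = \<theta>\<^sub>2" using assms by simp_all
  have "(\<lambda>l. tv_dist (gibbs_law n \<theta>\<^sub>1 \<theta>\<^sub>2 y\<^sub>0 l)
      (measure_pmf (map_pmf (spin n) (two_star_model n \<beta>\<^sub>1 \<beta>\<^sub>2)))) \<longlonglongrightarrow> 0"
    if "y\<^sub>0 \<in> spins n" for y\<^sub>0
  proof -
    obtain Q where Q: "gibbs_step n \<theta>\<^sub>1 \<theta>\<^sub>2 = (\<lambda>y. measure_pmf (Q y))"
      and em: "\<And>y A. emeasure (measure_pmf (Q y)) A = (\<integral>\<^sup>+\<phi>. emeasure (measure_pmf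
          (spin_given_phi n \<theta>\<^sub>1 \<theta>\<^sub>2 \<phi>)) A \<partial>phi_given_spin n \<theta>\<^sub>2 y)"
      and supp: "\<And>y. set_pmf (Q y) = spins n"
      using gibbs_step_kernel[OF n t] by metis
    show ?thesis
      unfolding gibbs_law_eq[OF Q]
    proof (rule positive_finite_chain_converges[of "spins n"])
      show "finite (spins n)"
        by (simp add: spins_def finite_sym_matrices)
      show "set_pmf (Q y) = spins n" for y
        by (rule supp)
      show "set_pmf (map_pmf (spin n) (two_star_model n \<beta>\<^sub>1 \<beta>\<^sub>2)) \<subseteq> spins n"
        using spin_image_graphs[of n] by (auto simp: set_pmf_iff pmf_two_star_model split: if_splits)
      show "bind_pmf (map_pmf (spin n) (two_star_model n \<beta>\<^sub>1 \<beta>\<^sub>2)) Q =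
          map_pmf (spin n) (two_star_model n \<beta>\<^sub>1 \<beta>\<^sub>2)"
        by (rule gibbs_stationary[OF n b, where \<beta>\<^sub>1 = \<beta>\<^sub>1, unfolded \<theta>, OF em])
      show "set_pmf (return_pmf y\<^sub>0) \<subseteq> spins n"
        using that by simp
    qed
  qed
  then show ?thesis
    using edge_prob_alt phi_law_bind_graph_given_phi[OF n b, of \<beta>\<^sub>1, unfolded \<theta>]
      is_cond_law_joint_law[OF n b, of \<beta>\<^sub>1, unfolded \<theta>] pmf_graph_given_phi[unfolded edge_factor_def]
    by (intro conjI allI ballI) blast+
qed

end
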